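(* Let $G_0=Sp(\infty;\mathbb R)$. The bounded symmetric domain $D_0=G_0(\mathcal F)$, $\mathcal F=(0,V_-,V)$, is realized as the bounded domain consisting of all finitary linear maps $Z:V_-\to V_+$ such that the matrix of $Z$ is symmetric and $I-Z^*Z$ is positive definite; here $(0,F^{(1)},V)\in D_0$ corresponds to the map $Z$ given by $\pi_-(x)\mapsto\pi_+(x)$ for $x\in F^{(1)}$. In that realization the action of $G_0$ is $$\begin{pmatrix}A&B\\C&D\end{pmatrix}:Z\mapsto(AZ+B)(CZ+D)^{-1}.$$
   Context: $V$ is the complex vector space with countable basis $E=\{\dots,e_{-2},e_{-1};e_1,e_2,\dots\}$, hermitian form $h(e_i,e_j)=\delta_{i,j}$ for $i<0$, $h(e_i,e_j)=-\delta_{i,j}$ for $i>0$, and antisymmetric bilinear form $b(e_i,e_j)=\delta_{i+j,0}$ for $i<0$, $b(e_i,e_j)=-\delta_{i+j,0}$ for $i>0$. $V_+=\mathrm{Span}\{e_i\mid i<0\}$, $V_-=\mathrm{Span}\{e_i\mid i>0\}$, and $\pi_\pm:V\to V_\pm$ are the $h$-orthogonal projections. $G=Sp(\infty;\mathbb C)$ is the group of linear transformations of $V$ preserving $b$ and fixing all but finitely many elements of $E$; $G_0=Sp(\infty;\mathbb R)$ is the subgroup of $G$ preserving $h$. Elements of $G_0$ are written in block form relative to $V=V_+\oplus V_-$. $\mathcal Z_{\mathcal F,E}=G(\mathcal F)$ is the complex flag manifold, and $D_0=G_0(\mathcal F)$ consists of the $(0,F^{(1)},V)\in\mathcal Z_{\mathcal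 F,E}$ with $F^{(1)}$ a maximal $h$-negative definite $b$-isotropic subspace of $V$. A linear map $Z:V_-\to V_+$ is finitary if its matrix has only finitely many nonzero entries. The matrix of $Z$ is $(z_{j,i})_{i,j>0}$ where $Z(e_i)=\sum_{j>0}z_{j,i}e_{-j}$; symmetric means $z_{j,i}=z_{i,j}$; $Z^*$ is the conjugate transpose. *)

theory Defs
  imports "HOL-Analysis.Analysis"
begin

text \<open>A vector is the family of its coordinates, indexed by the nonzero integers.
  Indices are plain integers, so the coordinate at \<open>0\<close> is required to vanish, and
  \<open>basis 0\<close> is the zero vector, not an element of the basis \<open>E\<close>.\<close>

typedef vec_inf = "{x :: int \<Rightarrow> complex. x 0 = 0 \<and> finite {i. x i \<noteq> 0}}"
  morphisms coord Abs_vec_inf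
  by (rule exI[of _ "\<lambda>_. 0"]) simp

setup_lifting type_definition_vec_inf

instantiation vec_inf :: ab_group_add
begin

lift_definition zero_vec_inf :: vec_inf is "\<lambda>_. 0" by simp

lift_definition plus_vec_inf :: "vec_inf \<Rightarrow> vec_inf \<Rightarrow> vec_inf" is "\<lambda>x y i. x i + y i"
proof -
  fix x y :: "int \<Rightarrow> complex"
  assume a: "x 0 = 0 \<and> finite {i. x i \<noteq> 0}" "y 0 = 0 \<and> finite {i. y i \<noteq> 0}"
  have "{i. x i + y i \<noteq> 0} \<subseteq> {i. x i \<noteq> 0} \<union> {i. y i \<noteq> 0}" by auto
  with a show "x 0 + y 0 = 0 \<and> finite {i. x i + y i \<noteq> 0}"
    by (simp add: finite_subset)
qed

lift_definition uminus_vec_inf :: "vec_inf \<Rightarrow> vec_inf" is "\<lambda>x i. - x i"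
  by simp

lift_definition minus_vec_inf :: "vec_inf \<Rightarrow> vec_inf \<Rightarrow> vec_inf" is "\<lambda>x y i. x i - y i"
proof -
  fix x y :: "int \<Rightarrow> complex"
  assume a: "x 0 = 0 \<and> finite {i. x i \<noteq> 0}" "y 0 = 0 \<and> finite {i. y i \<noteq> 0}"
  have "{i. x i - y i \<noteq> 0} \<subseteq> {i. x i \<noteq> 0} \<union> {i. y i \<noteq> 0}" by auto
  with a show "x 0 - y 0 = 0 \<and> finite {i. x i - y i \<noteq> 0}"
    by (simp add: finite_subset)
qed

instance
  by standard (transfer, simp add: algebra_simps)+

end

lift_definition scale :: "complex \<Rightarrow> vec_inf \<Rightarrow> vec_inf" is "\<lambda>c x i. c * x i"
  by (auto elim!: rev_finite_subset)

interpretation V: vector_space scale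
  by standard (transfer, simp add: algebra_simps)+

lift_definition basis :: "int \<Rightarrow> vec_inf" is "\<lambda>i k. if k = i \<and> i \<noteq> 0 then 1 else 0"
  by (auto intro: finite_subset[of _ "{_}"])

definition supp :: "vec_inf \<Rightarrow> int set" where
  "supp x = {i. coord x i \<noteq> 0}"

text \<open>The sesquilinear form is linear in its first argument.\<close>

definition h :: "vec_inf \<Rightarrow> vec_inf \<Rightarrow> complex" where
  "h x y = (\<Sum>i\<in>supp x \<inter> {..<0}. coord x i * cnj (coord y i))
         - (\<Sum>i\<in>supp x \<inter> {0<..}. coord x i * cnj (coord y i))"

definition b :: "vec_inf \<Rightarrow> vec_inf \<Rightarrow> complex" where
  "b x y = (\<Sum>i\<in>supp x \<inter> {..<0}. coord x i * coord y (- i))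
         - (\<Sum>i\<in>supp x \<inter> {0<..}. coord x i * coord y (- i))"

definition Vplus :: "vec_inf set" where
  "Vplus = V.span {basis i |i. i < 0}"

definition Vminus :: "vec_inf set" where
  "Vminus = V.span {basis i |i. 0 < i}"

lift_definition pi_plus :: "vec_inf \<Rightarrow> vec_inf" is "\<lambda>x i. if i < 0 then x i else 0"
  by (auto elim!: rev_finite_subset)

lift_definition pi_minus :: "vec_inf \<Rightarrow> vec_inf" is "\<lambda>x i. if 0 < i then x i else 0"
  by (auto elim!: rev_finite_subset)

lemma coord_basis: "coord (basis i) k = (if k = i \<and> i \<noteq> 0 then 1 else 0)"
  by transfer simp

lemma supp_basis: "supp (basis i) = (if i = 0 then {} else {i})"
  by (auto simp: supp_def coord_basis)

lemma h_basis:
  assumes "i \<noteq> 0" "j \<noteq> 0"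
  shows "h (basis i) (basis j) = (if i = j then if i < 0 then 1 else -1 else 0)"
  using assms by (auto simp: h_def supp_basis coord_basis)

lemma b_basis:
  assumes "i \<noteq> 0" "j \<noteq> 0"
  shows "b (basis i) (basis j) = (if i + j = 0 then if i < 0 then 1 else -1 else 0)"
  using assms by (auto simp: b_def supp_basis coord_basis)

lemma finite_supp [simp]: "finite (supp x)"
  unfolding supp_def by transfer simp

lemma vec_inf_eqI: "(\<And>i. coord x i = coord y i) \<Longrightarrow> x = y"
  by (metis coord_inject ext)

lemma coord_add: "coord (x + y) i = coord x i + coord y i"
  by transfer simp

lemma coord_diff: "coord (x - y) i = coord x i - coord y i"
  by transfer simp

lemma coord_scale: "coord (scale c x) i = c * coord x i"
  by transfer simp

lemma coord_zero [simp]: "coord 0 i = 0"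
  by transfer simp

lemma coord_0 [simp]: "coord x 0 = 0"
  by transfer simp

lemma coord_sum: "coord (\<Sum>k\<in>A. f k) i = (\<Sum>k\<in>A. coord (f k) i)"
  by (induction A rule: infinite_finite_induct) (auto simp: coord_add)

lemma vec_inf_expansion: "x = (\<Sum>i\<in>supp x. scale (coord x i) (basis i))"
proof (rule vec_inf_eqI)
  fix k
  have "coord (\<Sum>i\<in>supp x. scale (coord x i) (basis i)) k
      = (\<Sum>i\<in>supp x. if i = k then coord x k else 0)"
    unfolding coord_sum coord_scale coord_basis by (intro sum.cong) auto
  also have "\<dots> = coord x k" by (subst sum.delta) (simp_all, simp add: supp_def)
  finally show "coord x k = coord (\<Sum>i\<in>supp x. scale (coord x i) (basis i)) k" by simp
qed

lemma span_basis:
  assumes "0 \<notin> A"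
  shows "V.span {basis i |i. i \<in> A} = {x. supp x \<subseteq> A}"
proof
  have "V.subspace {x. supp x \<subseteq> A}"
    unfolding V.subspace_def supp_def by (force simp: coord_add coord_scale)
  then show "V.span {basis i |i. i \<in> A} \<subseteq> {x. supp x \<subseteq> A}"
    by (intro V.span_minimal) (auto simp: supp_basis split: if_splits)
next
  show "{x. supp x \<subseteq> A} \<subseteq> V.span {basis i |i. i \<in> A}"
  proof
    fix x assume "x \<in> {x. supp x \<subseteq> A}"
    then have "(\<Sum>i\<in>supp x. scale (coord x i) (basis i)) \<in> V.span {basis i |i. i \<in> A}"
      by (intro V.span_sum V.span_scale V.span_base) auto
    then show "x \<in> V.span {basis i |i. i \<in> A}" using vec_inf_expansion[of x] by simp
  qed
qed

lemma Vplus_iff: "x \<in> Vplus \<longleftrightarrow> supp x \<subseteq> {..<0}"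
  using span_basis[of "{..<0}"] by (simp add: Vplus_def)

lemma Vminus_iff: "x \<in> Vminus \<longleftrightarrow> supp x \<subseteq> {0<..}"
  using span_basis[of "{0<..}"] by (simp add: Vminus_def)

text \<open>\<open>pi_plus\<close> and \<open>pi_minus\<close> are the \<open>h\<close>-orthogonal projections.\<close>

lemma pi_plus_orthogonal:
  "pi_plus x \<in> Vplus" "v \<in> Vplus \<Longrightarrow> h (x - pi_plus x) v = 0"
proof -
  have c: "coord (pi_plus x) i = (if i < 0 then coord x i else 0)" for i
    by transfer simp
  show "pi_plus x \<in> Vplus" by (auto simp: Vplus_iff supp_def c split: if_splits)
  assume "v \<in> Vplus"
  then have "coord v i = 0" if "i > 0" for i
    using that by (force simp: Vplus_iff supp_def)
  then show "h (x - pi_plus x) v = 0" by (simp add: h_def coord_diff c)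
qed

lemma pi_minus_orthogonal:
  "pi_minus x \<in> Vminus" "v \<in> Vminus \<Longrightarrow> h (x - pi_minus x) v = 0"
proof -
  have c: "coord (pi_minus x) i = (if 0 < i then coord x i else 0)" for i
    by transfer simp
  show "pi_minus x \<in> Vminus" by (auto simp: Vminus_iff supp_def c split: if_splits)
  assume "v \<in> Vminus"
  then have "coord v i = 0" if "i < 0" for i
    using that by (force simp: Vminus_iff supp_def)
  then show "h (x - pi_minus x) v = 0" by (simp add: h_def coord_diff c)
qed

definition Sp_inf_C :: "(vec_inf \<Rightarrow> vec_inf) set" where
  "Sp_inf_C = {g. Vector_Spaces.linear scale scale g \<and> bij g
     \<and> (\<forall>x y. b (g x) (g y) = b x y)
     \<and> finite {i. i \<noteq> 0 \<and> g (basis i) \<noteq> basis i}}"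

definition Sp_inf_R :: "(vec_inf \<Rightarrow> vec_inf) set" where
  "Sp_inf_R = {g \<in> Sp_inf_C. \<forall>x y. h (g x) (g y) = h x y}"

type_synonym flag = "vec_inf set \<times> vec_inf set \<times> vec_inf set"

fun flag_act :: "(vec_inf \<Rightarrow> vec_inf) \<Rightarrow> flag \<Rightarrow> flag" where
  "flag_act g (F0, F1, F2) = (g ` F0, g ` F1, g ` F2)"

definition base_flag :: flag where
  "base_flag = ({0}, Vminus, UNIV)"

definition D0 :: "flag set" where
  "D0 = (\<lambda>g. flag_act g base_flag) ` Sp_inf_R"

definition lin_maps :: "vec_inf set \<Rightarrow> vec_inf set \<Rightarrow> (vec_inf \<Rightarrow> vec_inf) set" where
  "lin_maps U W = {f \<in> U \<rightarrow>\<^sub>E W. (\<forall>x\<in>U. \<forall>y\<in>U. f (x + y) = f x + f y)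
                              \<and> (\<forall>c. \<forall>x\<in>U. f (scale c x) = scale c (f x))}"

text \<open>Blocks relative to \<open>V = Vplus \<oplus> Vminus\<close>; each is a map on its own summand,
  in the function-space convention of being \<open>undefined\<close> outside it.\<close>

definition block_A :: "(vec_inf \<Rightarrow> vec_inf) \<Rightarrow> vec_inf \<Rightarrow> vec_inf" where
  "block_A g = (\<lambda>x\<in>Vplus. pi_plus (g x))"

definition block_B :: "(vec_inf \<Rightarrow> vec_inf) \<Rightarrow> vec_inf \<Rightarrow> vec_inf" where
  "block_B g = (\<lambda>x\<in>Vminus. pi_plus (g x))"

definition block_C :: "(vec_inf \<Rightarrow> vec_inf) \<Rightarrow> vec_inf \<Rightarrow> vec_inf" where
  "block_C g = (\<lambda>x\<in>Vplus. pi_minus (g x))"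

definition block_D :: "(vec_inf \<Rightarrow> vec_inf) \<Rightarrow> vec_inf \<Rightarrow> vec_inf" where
  "block_D g = (\<lambda>x\<in>Vminus. pi_minus (g x))"

definition AZ_plus_B :: "(vec_inf \<Rightarrow> vec_inf) \<Rightarrow> (vec_inf \<Rightarrow> vec_inf) \<Rightarrow> vec_inf \<Rightarrow> vec_inf" where
  "AZ_plus_B g Z = (\<lambda>x\<in>Vminus. block_A g (Z x) + block_B g x)"

definition CZ_plus_D :: "(vec_inf \<Rightarrow> vec_inf) \<Rightarrow> (vec_inf \<Rightarrow> vec_inf) \<Rightarrow> vec_inf \<Rightarrow> vec_inf" where
  "CZ_plus_D g Z = (\<lambda>x\<in>Vminus. block_C g (Z x) + block_D g x)"

text \<open>The inverse is the one of a map from \<open>Vminus\<close> to \<open>Vminus\<close>; it is meaningful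
  only where \<open>CZ_plus_D g Z\<close> is a bijection of \<open>Vminus\<close>.\<close>

definition frac_lin :: "(vec_inf \<Rightarrow> vec_inf) \<Rightarrow> (vec_inf \<Rightarrow> vec_inf) \<Rightarrow> vec_inf \<Rightarrow> vec_inf" where
  "frac_lin g Z = compose Vminus (AZ_plus_B g Z) (inv_into Vminus (CZ_plus_D g Z))"

text \<open>The map \<open>pi_minus x \<mapsto> pi_plus x\<close> for \<open>x \<in> F1\<close>; it is well defined
  with domain \<open>Vminus\<close> only if \<open>pi_minus\<close> is a bijection from \<open>F1\<close> to \<open>Vminus\<close>.\<close>

fun flag_map :: "flag \<Rightarrow> vec_inf \<Rightarrow> vec_inf" where
  "flag_map (F0, F1, F2) = (\<lambda>y\<in>Vminus. pi_plus (inv_into F1 pi_minus y))"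

text \<open>Only entries with positive indices are meaningful.\<close>

type_synonym matrix_inf = "int \<Rightarrow> int \<Rightarrow> complex"

definition mat_of :: "(vec_inf \<Rightarrow> vec_inf) \<Rightarrow> matrix_inf" where
  "mat_of Z j i = coord (Z (basis i)) (- j)"

definition finitary :: "matrix_inf \<Rightarrow> bool" where
  "finitary M \<longleftrightarrow> finite {(j, i). 0 < j \<and> 0 < i \<and> M j i \<noteq> 0}"

definition symmetric :: "matrix_inf \<Rightarrow> bool" where
  "symmetric M \<longleftrightarrow> (\<forall>i>0. \<forall>j>0. M j i = M i j)"

definition mat_one :: matrix_inf where
  "mat_one i k = (if i = k then 1 else 0)"

definition mat_star :: "matrix_inf \<Rightarrow> matrix_inf" where
  "mat_star M i j = cnj (M j i)"

text \<open>The index set is finite whenever one of the factors is finitary.\<close>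

definition mat_times :: "matrix_inf \<Rightarrow> matrix_inf \<Rightarrow> matrix_inf" where
  "mat_times M N i k = (\<Sum>j\<in>{j. 0 < j \<and> M i j * N j k \<noteq> 0}. M i j * N j k)"

definition mat_minus :: "matrix_inf \<Rightarrow> matrix_inf \<Rightarrow> matrix_inf" where
  "mat_minus M N i k = M i k - N i k"

definition pos_def :: "matrix_inf \<Rightarrow> bool" where
  "pos_def M \<longleftrightarrow> (\<forall>i>0. \<forall>k>0. M k i = cnj (M i k))
     \<and> (\<forall>x\<in>Vminus. x \<noteq> 0 \<longrightarrow>
          0 < Re (\<Sum>i\<in>supp x. \<Sum>k\<in>supp x. cnj (coord x i) * M i k * coord x k))"

definition sym_maps :: "(vec_inf \<Rightarrow> vec_inf) set" where
  "sym_maps = {Z \<in> lin_maps Vminus Vplus. finitary (mat_of Z) \<and> symmetric (mat_of Z)}"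

definition sym_domain :: "(vec_inf \<Rightarrow> vec_inf) set" where
  "sym_domain = {Z \<in> lin_maps Vminus Vplus. finitary (mat_of Z) \<and> symmetric (mat_of Z)
     \<and> pos_def (mat_minus mat_one (mat_times (mat_star (mat_of Z)) (mat_of Z)))}"

text \<open>\<open>sym_maps\<close> is the union of the finite-dimensional spaces \<open>sym_maps_le n\<close> of
  symmetric \<open>n \<times> n\<close> matrices, and carries the direct limit of their usual topologies.\<close>

definition sym_maps_le :: "int \<Rightarrow> (vec_inf \<Rightarrow> vec_inf) set" where
  "sym_maps_le n = {Z \<in> sym_maps. \<forall>i>0. \<forall>j>0. n < i \<or> n < j \<longrightarrow> mat_of Z j i = 0}"

definition ind_open :: "(vec_inf \<Rightarrow> vec_inf) set \<Rightarrow> bool" where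
  "ind_open U \<longleftrightarrow> U \<subseteq> sym_maps \<and>
     (\<forall>n. \<forall>Z\<in>U \<inter> sym_maps_le n. \<exists>\<epsilon>>0. \<forall>W\<in>sym_maps_le n.
        (\<forall>i\<in>{1..n}. \<forall>j\<in>{1..n}. cmod (mat_of W j i - mat_of Z j i) < \<epsilon>) \<longrightarrow> W \<in> U)"

definition ind_topology :: "(vec_inf \<Rightarrow> vec_inf) topology" where
  "ind_topology = topology ind_open"

lemma istopology_ind_open: "istopology ind_open"
  unfolding istopology_def
proof (intro conjI allI impI)
  fix S T assume S: "ind_open S" and T: "ind_open T"
  show "ind_open (S \<inter> T)"
    unfolding ind_open_def
  proof (intro conjI allI ballI)
    show "S \<inter> T \<subseteq> sym_maps" using S by (auto simp: ind_open_def)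
    fix n Z assume Z: "Z \<in> S \<inter> T \<inter> sym_maps_le n"
    obtain d where d: "d > 0" "\<And>W. W \<in> sym_maps_le n \<Longrightarrow>
        (\<forall>i\<in>{1..n}. \<forall>j\<in>{1..n}. cmod (mat_of W j i - mat_of Z j i) < d) \<Longrightarrow> W \<in> S"
      using S Z unfolding ind_open_def by blast
    obtain e where e: "e > 0" "\<And>W. W \<in> sym_maps_le n \<Longrightarrow>
        (\<forall>i\<in>{1..n}. \<forall>j\<in>{1..n}. cmod (mat_of W j i - mat_of Z j i) < e) \<Longrightarrow> W \<in> T"
      using T Z unfolding ind_open_def by blast
    show "\<exists>\<epsilon>>0. \<forall>W\<in>sym_maps_le n.
        (\<forall>i\<in>{1..n}. \<forall>j\<in>{1..n}. cmod (mat_of W j i - mat_of Z j i) < \<epsilon>) \<longrightarrow> W \<in> S \<inter> T"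
      using d e by (intro exI[of _ "min d e"]) auto
  qed
next
  fix K assume K: "\<forall>S\<in>K. ind_open S"
  show "ind_open (\<Union>K)"
    unfolding ind_open_def
  proof (intro conjI allI ballI)
    show "\<Union>K \<subseteq> sym_maps" using K by (auto simp: ind_open_def)
    fix n Z assume "Z \<in> \<Union>K \<inter> sym_maps_le n"
    then obtain S where S: "S \<in> K" "Z \<in> S \<inter> sym_maps_le n" by auto
    then obtain d where "d > 0" "\<forall>W\<in>sym_maps_le n.
        (\<forall>i\<in>{1..n}. \<forall>j\<in>{1..n}. cmod (mat_of W j i - mat_of Z j i) < d) \<longrightarrow> W \<in> S"
      using K unfolding ind_open_def by blast
    then show "\<exists>\<epsilon>>0. \<forall>W\<in>sym_maps_le n.
        (\<forall>i\<in>{1..n}. \<forall>j\<in>{1..n}. cmod (mat_of W j i - mat_of Z j i) < \<epsilon>) \<longrightarrow> W \<in> \<Union>K"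
      using S(1) by blast
  qed
qed

lemma openin_ind_topology: "openin ind_topology U \<longleftrightarrow> ind_open U"
  by (simp add: ind_topology_def topology_inverse'[OF istopology_ind_open])

definition vec_norm :: "vec_inf \<Rightarrow> real" where
  "vec_norm x = sqrt (\<Sum>i\<in>supp x. (cmod (coord x i))\<^sup>2)"

text \<open>Boundedness is uniform boundedness of the operator norms.\<close>

definition bounded_domain :: "(vec_inf \<Rightarrow> vec_inf) set \<Rightarrow> bool" where
  "bounded_domain U \<longleftrightarrow> U \<noteq> {} \<and> openin ind_topology U \<and> connectedin ind_topology U
     \<and> (\<exists>C. \<forall>Z\<in>U. \<forall>x\<in>Vminus. vec_norm (Z x) \<le> C * vec_norm x)"

end

theory Submission
  imports Defs
begin

text \<open>A subspace \<open>g ` Vminus\<close> with \<open>g \<in> Sp_inf_R\<close> is negative definite, so \<open>pi_minus\<close> is injective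
  on it; since \<open>g\<close> moves only finitely many basis vectors, \<open>pi_minus \<circ> g\<close> is also onto \<open>Vminus\<close> by
  a dimension count, and the subspace is the graph of a map \<open>Z\<close>. Isotropy of the graph is
  symmetry of the matrix of \<open>Z\<close>, negativity is \<open>\<parallel>Z x\<parallel> < \<parallel>x\<parallel>\<close>, and the action formula is read off
  the graph. Conversely, Gram-Schmidt yields an \<open>h\<close>-orthonormal basis \<open>f\<^sub>i\<close> of the graph of a given
  \<open>Z\<close>. The antilinear involution \<open>conj_flip\<close> satisfies \<open>b x y = h x (conj_flip y)\<close> and reverses the
  sign of \<open>h\<close>, so mapping \<open>e\<^sub>i\<close> to \<open>f\<^sub>i\<close> and \<open>e\<^sub>-\<^sub>i\<close> to \<open>conj_flip f\<^sub>i\<close> preserves both forms.\<close>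

subsection \<open>Linear maps on coordinate subspaces\<close>

abbreviation lin :: "(vec_inf \<Rightarrow> vec_inf) \<Rightarrow> bool" where
  "lin \<equiv> Vector_Spaces.linear scale scale"

lemma lin_iff:
  "lin f \<longleftrightarrow> (\<forall>x y. f (x + y) = f x + f y) \<and> (\<forall>c x. f (scale c x) = scale c (f x))"
  by (simp add: Vector_Spaces.linear_iff V.vector_space_axioms)

lemma lin_add: "lin f \<Longrightarrow> f (x + y) = f x + f y"
  and lin_scale: "lin f \<Longrightarrow> f (scale c x) = scale c (f x)"
  by (auto simp: lin_iff)

lemma lin_zero: "lin f \<Longrightarrow> f 0 = 0"
  by (metis V.scale_zero_left lin_scale)

lemma lin_uminus: "lin f \<Longrightarrow> f (- x) = - f x"
  by (metis V.scale_minus_left V.scale_one lin_scale)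

lemma lin_diff: "lin f \<Longrightarrow> f (x - y) = f x - f y"
  by (metis diff_conv_add_uminus lin_add lin_uminus)

lemma lin_sum: "lin f \<Longrightarrow> f (\<Sum>i\<in>A. u i) = (\<Sum>i\<in>A. f (u i))"
  by (induction A rule: infinite_finite_induct) (auto simp: lin_zero lin_add)

lemma lin_compose: "lin f \<Longrightarrow> lin g \<Longrightarrow> lin (f \<circ> g)"
  by (simp add: lin_iff)

lemma lin_expand: "lin f \<Longrightarrow> f x = (\<Sum>i\<in>supp x. scale (coord x i) (f (basis i)))"
  by (subst vec_inf_expansion) (simp add: lin_sum lin_scale)

lemma lin_inj_on:
  assumes "lin f" "V.subspace U" "\<And>x. x \<in> U \<Longrightarrow> f x = 0 \<Longrightarrow> x = 0"
  shows "inj_on f U"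
proof (rule inj_onI)
  fix x y assume "x \<in> U" "y \<in> U" "f x = f y"
  with assms have "x - y = 0" by (metis V.subspace_diff eq_iff_diff_eq_0 lin_diff)
  then show "x = y" by simp
qed

lemma nonzero_supp: "i \<in> supp x \<Longrightarrow> i \<noteq> 0"
  by (auto simp: supp_def)

lemma functional_expand:
  fixes \<phi> :: "vec_inf \<Rightarrow> complex"
  assumes add: "\<And>x y. \<phi> (x + y) = \<phi> x + \<phi> y" and sc: "\<And>c x. \<phi> (scale c x) = c * \<phi> x"
  shows "\<phi> x = (\<Sum>i\<in>supp x. coord x i * \<phi> (basis i))"
proof -
  have "\<phi> 0 = 0" using add[of 0 0] by simp
  then have "\<phi> (\<Sum>i\<in>A. u i) = (\<Sum>i\<in>A. \<phi> (u i))" for A :: "int set" and u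
    by (induction A rule: infinite_finite_induct) (auto simp: add)
  then show ?thesis by (subst vec_inf_expansion) (simp add: sc)
qed

text \<open>Reduces identities between forms to basis vectors: fixing all arguments but one leaves a
  linear functional, and the arguments are treated one after the other.\<close>

lemma functional_eqI:
  fixes \<phi> \<psi> :: "vec_inf \<Rightarrow> complex"
  assumes "\<And>x y. \<phi> (x + y) = \<phi> x + \<phi> y" "\<And>c x. \<phi> (scale c x) = c * \<phi> x"
    and "\<And>x y. \<psi> (x + y) = \<psi> x + \<psi> y" "\<And>c x. \<psi> (scale c x) = c * \<psi> x"
    and "\<And>i. i \<noteq> 0 \<Longrightarrow> \<phi> (basis i) = \<psi> (basis i)"
  shows "\<phi> x = \<psi> x"
  unfolding functional_expand[of \<phi> x, OF assms(1,2)] functional_expand[of \<psi> x, OF assms(3,4)]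
  by (rule sum.cong) (auto simp: assms(5) nonzero_supp)

lemma lin_extension: "\<exists>f. lin f \<and> (\<forall>i. i \<noteq> 0 \<longrightarrow> f (basis i) = G i)"
proof -
  define f where "f x = (\<Sum>i\<in>supp x. scale (coord x i) (G i))" for x
  \<comment> \<open>Summing over any finite superset of the support gives the same value, so
    different vectors can be compared over one index set.\<close>
  have f: "f x = (\<Sum>i\<in>S. scale (coord x i) (G i))" if "finite S" "supp x \<subseteq> S" for x S
    unfolding f_def using that by (intro sum.mono_neutral_left) (auto simp: supp_def)
  have "f (x + y) = f x + f y" for x y
  proof -
    have "supp (x + y) \<subseteq> supp x \<union> supp y" by (auto simp: supp_def coord_add)
    then show ?thesis
      by (simp add: f[of "supp x \<union> supp y"] coord_add V.scale_left_distrib sum.distrib)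
  qed
  moreover have "f (scale c x) = scale c (f x)" for c x
  proof -
    have "supp (scale c x) \<subseteq> supp x" by (auto simp: supp_def coord_scale)
    then show ?thesis by (simp add: f[of "supp x"] coord_scale V.scale_sum_right)
  qed
  moreover have "f (basis i) = G i" if "i \<noteq> 0" for i
    using that by (simp add: f_def supp_basis coord_basis)
  ultimately show ?thesis by (auto simp: lin_iff)
qed

text \<open>The dimension count: a basis \<open>C\<close> of the span goes to equally many
  independent vectors, and a vector of the span outside their span would yield
  \<open>card C + 1\<close> independent vectors inside the span of \<open>C\<close>.\<close>

lemma lin_inj_on_finite_span_surj:
  assumes f: "lin f" and B: "finite B" and into: "f ` V.span B \<subseteq> V.span B"
    and inj: "inj_on f (V.span B)"
  shows "f ` V.span B = V.span B"
proof -
  interpret vector_space_pair scale scale ..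
  obtain C where C: "C \<subseteq> B" "V.independent C" "V.span C = V.span B"
    by (metis V.maximal_independent_subset V.span_superset V.span_mono V.span_span
        subset_antisym subset_trans V.span_minimal V.subspace_span)
  have finC: "finite C" using C(1) B by (rule finite_subset)
  have indep: "V.independent (f ` C)"
    using f C inj by (intro linear_independent_injective_image) auto
  have card: "card (f ` C) = card C"
    by (rule card_image) (metis C(3) V.span_superset inj inj_on_subset)
  have "V.span B \<subseteq> V.span (f ` C)"
  proof (rule ccontr)
    assume "\<not> ?thesis"
    then obtain y where y: "y \<in> V.span B" "y \<notin> V.span (f ` C)" by auto
    then have "V.independent (insert y (f ` C))"
      using indep by (simp add: V.independent_insertI)
    moreover have "insert y (f ` C) \<subseteq> V.span C"
      using y(1) into C(3) V.span_superset[of C] by auto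
    ultimately have "card (insert y (f ` C)) \<le> card C"
      using V.independent_span_bound finC by blast
    moreover have "y \<notin> f ` C" using y(2) V.span_base by blast
    ultimately show False using card finC by simp
  qed
  moreover have "V.span (f ` C) = f ` V.span C"
    using f by (rule linear_span_image)
  ultimately show ?thesis using into C(3) by auto
qed

text \<open>Replaces finite dimensionality: all but finitely many basis vectors are fixed and hence
  in the image, while the others lie in a finite-dimensional subspace that \<open>f\<close>
  preserves, where injectivity implies surjectivity.\<close>

lemma finitary_inj_on_surj:
  assumes f: "lin f" and A: "0 \<notin> A" and U: "U = {x. supp x \<subseteq> A}"
    and into: "f ` U \<subseteq> U" and inj: "inj_on f U"
    and fin: "finite {i \<in> A. f (basis i) \<noteq> basis i}"
  shows "f ` U = U"
proof -
  interpret vector_space_pair scale scale ..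
  define S where "S = {i \<in> A. f (basis i) \<noteq> basis i}"
  \<comment> \<open>Adding the supports of the images makes the span over \<open>T\<close>
    invariant: indices in \<open>S\<close> are sent into it by construction, and the remaining ones
    are fixed.\<close>
  define T where "T = S \<union> (\<Union>i\<in>S. supp (f (basis i)))"
  have finT: "finite T" using fin by (simp add: T_def S_def)
  have basisU: "basis i \<in> U" if "i \<in> A" for i using that by (auto simp: U supp_basis)
  have TA: "T \<subseteq> A" using into basisU by (force simp: T_def S_def U)
  define B where "B = {basis i |i. i \<in> T}"
  have spanB: "V.span B = {x. supp x \<subseteq> T}" unfolding B_def using TA A by (intro span_basis) auto
  have BU: "V.span B \<subseteq> U" using TA by (auto simp: spanB U)
  have "f (basis i) \<in> V.span B" if "i \<in> T" for i
  proof (cases "i \<in> S")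
    case True
    then show ?thesis by (auto simp: spanB T_def)
  next
    case False
    then show ?thesis using that TA by (auto simp: S_def B_def intro!: V.span_base)
  qed
  then have "f ` B \<subseteq> V.span B" by (auto simp: B_def)
  then have "f ` V.span B \<subseteq> V.span B"
    unfolding linear_span_image[OF f, symmetric] by (intro V.span_minimal V.subspace_span)
  moreover have "finite B" using finT by (simp add: B_def)
  ultimately have surj: "f ` V.span B = V.span B"
    using f inj BU by (intro lin_inj_on_finite_span_surj) (auto intro: inj_on_subset)
  have spanU: "U = V.span {basis i |i. i \<in> A}" using span_basis[OF A] U by simp
  have sub: "V.subspace (f ` U)"
    unfolding spanU by (rule linear_subspace_image[OF f V.subspace_span])
  have "basis i \<in> f ` U" if "i \<in> A" for i
  proof (cases "i \<in> T")
    case True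
    then have "basis i \<in> V.span B" by (auto simp: B_def intro!: V.span_base)
    then show ?thesis using surj BU by blast
  next
    case False
    then have "f (basis i) = basis i" using that by (auto simp: T_def S_def)
    then show ?thesis using basisU[OF that] by (metis imageI)
  qed
  then have "{basis i |i. i \<in> A} \<subseteq> f ` U" by auto
  then have "U \<subseteq> f ` U" using V.span_minimal[OF _ sub] by (subst (1) spanU)
  then show ?thesis using into by auto
qed

subsection \<open>The forms and the conjugation\<close>

lemma coord_pi_plus: "coord (pi_plus x) i = (if i < 0 then coord x i else 0)"
  by transfer simp

lemma coord_pi_minus: "coord (pi_minus x) i = (if 0 < i then coord x i else 0)"
  by transfer simp

lemmas coord_simps = coord_add coord_diff coord_scale coord_pi_plus coord_pi_minus coord_basis

lemma lin_pi_plus: "lin pi_plus" and lin_pi_minus: "lin pi_minus"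
  by (auto simp: lin_iff coord_simps intro!: vec_inf_eqI)

lemma Vplus_coord: "x \<in> Vplus \<longleftrightarrow> (\<forall>i\<ge>0. coord x i = 0)"
  by (simp add: Vplus_iff supp_def subset_eq) (metis not_less)

lemma Vminus_coord: "x \<in> Vminus \<longleftrightarrow> (\<forall>i\<le>0. coord x i = 0)"
  by (simp add: Vminus_iff supp_def subset_eq) (metis not_less)

lemma pi_plus_in [simp]: "pi_plus x \<in> Vplus" and pi_minus_in [simp]: "pi_minus x \<in> Vminus"
  by (auto simp: Vplus_coord Vminus_coord coord_simps)

lemma pi_plus_id: "x \<in> Vplus \<Longrightarrow> pi_plus x = x"
  and pi_minus_Vplus: "x \<in> Vplus \<Longrightarrow> pi_minus x = 0"
  by (auto simp: Vplus_coord coord_simps intro!: vec_inf_eqI)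

lemma pi_minus_id: "x \<in> Vminus \<Longrightarrow> pi_minus x = x"
  and pi_plus_Vminus: "x \<in> Vminus \<Longrightarrow> pi_plus x = 0"
  by (auto simp: Vminus_coord coord_simps intro!: vec_inf_eqI)

lemma pi_sum: "pi_plus x + pi_minus x = x"
  by (rule vec_inf_eqI) (auto simp: coord_simps not_less order.order_iff_strict)

lemma subspace_Vplus: "V.subspace Vplus" and subspace_Vminus: "V.subspace Vminus"
  by (auto simp: Vplus_def Vminus_def)

lemma basis_Vminus: "0 < i \<Longrightarrow> basis i \<in> Vminus"
  by (auto simp: Vminus_coord coord_simps)

text \<open>The sign pattern shared by \<open>h\<close> and \<open>b\<close>, which turns each into
  a single sum; at index \<open>0\<close> it takes the value \<open>-1\<close>, which always meets a
  zero coordinate.\<close>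

definition sg :: "int \<Rightarrow> complex" where
  "sg i = (if i < 0 then 1 else -1)"

lemma h_eq:
  assumes "finite S" "supp x \<subseteq> S"
  shows "h x y = (\<Sum>i\<in>S. sg i * (coord x i * cnj (coord y i)))"
proof -
  have "(\<Sum>i\<in>S. sg i * (coord x i * cnj (coord y i)))
      = (\<Sum>i\<in>supp x. sg i * (coord x i * cnj (coord y i)))"
    using assms by (intro sum.mono_neutral_right) (auto simp: supp_def)
  also have "supp x = (supp x \<inter> {..<0}) \<union> (supp x \<inter> {0<..})"
    by (auto simp: supp_def not_less order.order_iff_strict)
  also have "(\<Sum>i\<in>\<dots>. sg i * (coord x i * cnj (coord y i))) = h x y"
    by (subst sum.union_disjoint) (auto simp: h_def sg_def sum_negf)
  finally show ?thesis by simp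
qed

lemma b_eq:
  assumes "finite S" "supp x \<subseteq> S"
  shows "b x y = (\<Sum>i\<in>S. sg i * (coord x i * coord y (- i)))"
proof -
  have "(\<Sum>i\<in>S. sg i * (coord x i * coord y (- i)))
      = (\<Sum>i\<in>supp x. sg i * (coord x i * coord y (- i)))"
    using assms by (intro sum.mono_neutral_right) (auto simp: supp_def)
  also have "supp x = (supp x \<inter> {..<0}) \<union> (supp x \<inter> {0<..})"
    by (auto simp: supp_def not_less order.order_iff_strict)
  also have "(\<Sum>i\<in>\<dots>. sg i * (coord x i * coord y (- i))) = b x y"
    by (subst sum.union_disjoint) (auto simp: b_def sg_def sum_negf)
  finally show ?thesis by simp
qed

lemma h_add_right: "h x (y + z) = h x y + h x z"
  and h_scale_right: "h x (scale c y) = cnj c * h x y"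
  by (auto simp: h_eq[of "supp x"] coord_simps algebra_simps sum.distrib sum_distrib_left)

lemma h_commute: "h y x = cnj (h x y)"
  by (auto simp: h_eq[of "supp x \<union> supp y"] sg_def mult_ac intro!: sum.cong)

lemma h_add_left: "h (x + y) z = h x z + h y z"
  and h_scale_left: "h (scale c x) z = c * h x z"
  using h_commute[of _ z] by (simp_all add: h_add_right h_scale_right)

lemma h_zero_right [simp]: "h x 0 = 0" by (simp add: h_def)

lemma h_zero_left [simp]: "h 0 x = 0" by (simp add: h_def supp_def)

lemma h_sum_left: "h (\<Sum>i\<in>A. u i) z = (\<Sum>i\<in>A. h (u i) z)"
  by (induction A rule: infinite_finite_induct) (auto simp: h_add_left)

lemma b_add_right: "b x (y + z) = b x y + b x z"
  and b_scale_right: "b x (scale c y) = c * b x y"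
  by (auto simp: b_eq[of "supp x"] coord_simps algebra_simps sum.distrib sum_distrib_left)

lemma b_add_left: "b (x + y) z = b x z + b y z"
proof -
  have "supp (x + y) \<subseteq> supp x \<union> supp y" by (auto simp: supp_def coord_simps)
  then show ?thesis
    by (simp add: b_eq[of "supp x \<union> supp y"] coord_simps algebra_simps sum.distrib)
qed

lemma b_scale_left: "b (scale c x) z = c * b x z"
proof -
  have "supp (scale c x) \<subseteq> supp x" by (auto simp: supp_def coord_simps)
  then show ?thesis
    by (simp add: b_eq[of "supp x"] coord_simps algebra_simps sum_distrib_left)
qed

lemma h_basis_right: "i \<noteq> 0 \<Longrightarrow> h x (basis i) = sg i * coord x i"
proof -
  assume "i \<noteq> 0"
  then have "h x (basis i) = (\<Sum>k\<in>insert i (supp x). if k = i then sg i * coord x i else 0)"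
    unfolding h_eq[of "insert i (supp x)", OF finite.insertI[OF finite_supp] subset_insertI]
    by (intro sum.cong) (auto simp: coord_simps)
  then show "h x (basis i) = sg i * coord x i" by simp
qed

lemma h_preserved_on_basis:
  assumes f: "lin f"
    and e: "\<And>i j. i \<noteq> 0 \<Longrightarrow> j \<noteq> 0 \<Longrightarrow> h (f (basis i)) (f (basis j)) = h (basis i) (basis j)"
  shows "h (f x) (f y) = h x y"
proof -
  have 1: "h (f x) (f (basis j)) = h x (basis j)" if "j \<noteq> 0" for x j
    by (rule functional_eqI[where \<phi> = "\<lambda>x. h (f x) (f (basis j))"])
      (auto simp: lin_add[OF f] lin_scale[OF f] h_add_left h_scale_left e that)
  have "h (f y) (f x) = h y x" for x y
  proof -
    \<comment> \<open>\<open>h\<close> is antilinear in its second argument, so its conjugate is the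
      linear functional to compare.\<close>
    have "cnj (h (f x) (f y)) = cnj (h x y)"
      by (rule functional_eqI[where \<phi> = "\<lambda>y. cnj (h (f x) (f y))"])
        (auto simp: lin_add[OF f] lin_scale[OF f] h_add_right h_scale_right 1)
    then show ?thesis by (simp add: h_commute[of x y] h_commute[of "f x" "f y"])
  qed
  then show ?thesis .
qed

lemma b_preserved_on_basis:
  assumes f: "lin f"
    and e: "\<And>i j. i \<noteq> 0 \<Longrightarrow> j \<noteq> 0 \<Longrightarrow> b (f (basis i)) (f (basis j)) = b (basis i) (basis j)"
  shows "b (f x) (f y) = b x y"
proof -
  have 1: "b (f x) (f (basis j)) = b x (basis j)" if "j \<noteq> 0" for x j
    by (rule functional_eqI[where \<phi> = "\<lambda>x. b (f x) (f (basis j))"])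
      (auto simp: lin_add[OF f] lin_scale[OF f] b_add_left b_scale_left e that)
  show ?thesis
    by (rule functional_eqI[where \<phi> = "\<lambda>y. b (f x) (f y)"])
      (auto simp: lin_add[OF f] lin_scale[OF f] b_add_right b_scale_right 1)
qed

section \<open>The antilinear involution linking \<open>b\<close> to \<open>h\<close>\<close>

lift_definition conj_flip :: "vec_inf \<Rightarrow> vec_inf" is "\<lambda>x i. cnj (x (- i))"
proof -
  fix x :: "int \<Rightarrow> complex" assume "x 0 = 0 \<and> finite {i. x i \<noteq> 0}"
  moreover have "{i. cnj (x (- i)) \<noteq> 0} = uminus ` {i. x i \<noteq> 0}"
    by (auto intro: image_eqI[where x = "- _"])
  ultimately show "cnj (x (- 0)) = 0 \<and> finite {i. cnj (x (- i)) \<noteq> 0}" by simp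
qed

lemma coord_conj_flip: "coord (conj_flip x) i = cnj (coord x (- i))"
  by transfer simp

lemma conj_flip_basis: "conj_flip (basis i) = basis (- i)"
  by (rule vec_inf_eqI) (auto simp: coord_conj_flip coord_simps)

lemma conj_flip_flip [simp]: "conj_flip (conj_flip x) = x"
  by (rule vec_inf_eqI) (simp add: coord_conj_flip)

lemma b_eq_h: "b x y = h x (conj_flip y)"
  by (simp add: b_eq[of "supp x"] h_eq[of "supp x"] coord_conj_flip)

text \<open>Reflecting the index exchanges positive and negative basis vectors, which costs a sign;
  conjugating the coordinates swaps the two arguments.\<close>

lemma h_conj_flip: "h (conj_flip x) (conj_flip y) = - h y x"
proof -
  let ?S = "supp x \<union> supp y"
  have "supp (conj_flip x) \<subseteq> uminus ` ?S"
    by (auto simp: supp_def coord_conj_flip intro: image_eqI[where x = "- _"])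
  then have "h (conj_flip x) (conj_flip y)
      = (\<Sum>i\<in>uminus ` ?S. sg i * (cnj (coord x (- i)) * coord y (- i)))"
    by (simp add: h_eq[of "uminus ` ?S"] coord_conj_flip)
  also have "\<dots> = (\<Sum>i\<in>?S. sg (- i) * (cnj (coord x i) * coord y i))"
    by (subst sum.reindex) auto
  \<comment> \<open>The identity \<open>sg (- i) = - sg i\<close> fails at \<open>0\<close>, an
    index that no support contains.\<close>
  also have "\<dots> = (\<Sum>i\<in>?S. - (sg i * (coord y i * cnj (coord x i))))"
    by (intro sum.cong) (auto simp: sg_def supp_def less_le)
  also have "\<dots> = - h y x" by (simp add: h_eq[of ?S] sum_negf)
  finally show ?thesis .
qed

subsection \<open>The Euclidean norm\<close>

lemma vec_norm_L2:
  assumes "finite S" "supp x \<subseteq> S"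
  shows "vec_norm x = L2_set (\<lambda>i. cmod (coord x i)) S"
  unfolding vec_norm_def L2_set_def using assms
  by (intro arg_cong[where f = sqrt] sum.mono_neutral_left) (auto simp: supp_def)

lemma vec_norm_sq:
  assumes "finite S" "supp x \<subseteq> S"
  shows "(vec_norm x)\<^sup>2 = (\<Sum>i\<in>S. (cmod (coord x i))\<^sup>2)"
  by (simp add: vec_norm_L2[OF assms] L2_set_def sum_nonneg)

lemma vec_norm_nonneg [simp]: "0 \<le> vec_norm x"
  by (simp add: vec_norm_def sum_nonneg)

lemma vec_norm_zero [simp]: "vec_norm 0 = 0"
  by (simp add: vec_norm_def)

lemma vec_norm_eq_0 [simp]: "vec_norm x = 0 \<longleftrightarrow> x = 0"
proof
  assume "vec_norm x = 0"
  then have "\<forall>i\<in>supp x. coord x i = 0"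
    by (simp add: vec_norm_L2[of "supp x"] L2_set_eq_0_iff)
  then show "x = 0" by (intro vec_inf_eqI) (auto simp: supp_def)
qed simp

lemma coord_le_vec_norm: "cmod (coord x i) \<le> vec_norm x"
  unfolding vec_norm_L2[of "insert i (supp x)" x, OF finite.insertI[OF finite_supp] subset_insertI]
  by (rule member_le_L2_set) auto

lemma vec_norm_triangle: "vec_norm (x + y) \<le> vec_norm x + vec_norm y"
proof -
  let ?S = "supp x \<union> supp y"
  have "vec_norm (x + y) = L2_set (\<lambda>i. cmod (coord x i + coord y i)) ?S"
    by (subst vec_norm_L2[of ?S]) (auto simp: supp_def coord_simps finite_supp[unfolded supp_def])
  also have "\<dots> \<le> L2_set (\<lambda>i. cmod (coord x i) + cmod (coord y i)) ?S"
    by (rule L2_set_mono) (auto intro: norm_triangle_ineq)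
  also have "\<dots> \<le> vec_norm x + vec_norm y"
    by (simp add: vec_norm_L2[of ?S] L2_set_triangle_ineq)
  finally show ?thesis .
qed

lemma vec_norm_scale: "vec_norm (scale c x) = cmod c * vec_norm x"
proof -
  have "supp (scale c x) \<subseteq> supp x" by (auto simp: supp_def coord_simps)
  then show ?thesis
    by (simp add: vec_norm_L2[of "supp x"] coord_simps norm_mult L2_set_right_distrib)
qed

lemma vec_norm_sum: "vec_norm (\<Sum>i\<in>A. u i) \<le> (\<Sum>i\<in>A. vec_norm (u i))"
  by (induction A rule: infinite_finite_induct) (auto intro: order_trans[OF vec_norm_triangle])

lemma vec_norm_le_sum_coords:
  assumes "finite S" "supp x \<subseteq> S"
  shows "vec_norm x \<le> (\<Sum>i\<in>S. cmod (coord x i))"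
  unfolding vec_norm_L2[OF assms] by (rule L2_set_le_sum) auto

lemma vec_norm_pythagoras: "(vec_norm x)\<^sup>2 = (vec_norm (pi_plus x))\<^sup>2 + (vec_norm (pi_minus x))\<^sup>2"
proof -
  have "supp (pi_plus x) \<subseteq> supp x" "supp (pi_minus x) \<subseteq> supp x"
    by (auto simp: supp_def coord_simps)
  then show ?thesis
    unfolding vec_norm_sq[of "supp x" x, OF finite_supp order_refl]
      vec_norm_sq[OF finite_supp \<open>supp (pi_plus x) \<subseteq> supp x\<close>]
      vec_norm_sq[OF finite_supp \<open>supp (pi_minus x) \<subseteq> supp x\<close>]
    unfolding sum.distrib[symmetric]
    by (intro sum.cong) (auto simp: coord_simps dest: nonzero_supp)
qed

text \<open>Makes the value real and turns every definiteness argument into a comparison of two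
  Euclidean norms.\<close>

lemma h_self: "h x x = of_real ((vec_norm (pi_plus x))\<^sup>2 - (vec_norm (pi_minus x))\<^sup>2)"
proof -
  have s: "supp (pi_plus x) \<subseteq> supp x" "supp (pi_minus x) \<subseteq> supp x"
    by (auto simp: supp_def coord_simps)
  show ?thesis
    unfolding h_eq[OF finite_supp order_refl]
      vec_norm_sq[OF finite_supp s(1)] vec_norm_sq[OF finite_supp s(2)]
    unfolding sum_subtractf[symmetric] of_real_sum
    by (intro sum.cong)
      (auto simp: coord_simps sg_def complex_norm_square simp del: of_real_power dest: nonzero_supp)
qed

text \<open>Each coordinate is at most the norm of the vector, so finitely many nonzero values on
  the basis bound the whole map. It serves for \<open>g x - x\<close> with \<open>g\<close> in the
  group and for differences of finitary maps.\<close>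

lemma lin_finite_bound:
  assumes L: "lin L" and S: "finite S" "\<And>i. i \<noteq> 0 \<Longrightarrow> i \<notin> S \<Longrightarrow> L (basis i) = 0"
  shows "vec_norm (L x) \<le> (\<Sum>i\<in>S. vec_norm (L (basis i))) * vec_norm x"
proof -
  have "L x = (\<Sum>i\<in>S. scale (coord x i) (L (basis i)))"
  proof -
    have "L x = (\<Sum>i\<in>supp x \<union> S. scale (coord x i) (L (basis i)))"
      unfolding lin_expand[OF L, of x] using S(1)
      by (intro sum.mono_neutral_left) (auto simp: supp_def finite_supp[unfolded supp_def])
    also have "\<dots> = (\<Sum>i\<in>S. scale (coord x i) (L (basis i)))"
      using S by (intro sum.mono_neutral_right) (auto dest: nonzero_supp)
    finally show ?thesis .
  qed
  also have "vec_norm \<dots> \<le> (\<Sum>i\<in>S. cmod (coord x i) * vec_norm (L (basis i)))"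
    by (rule order_trans[OF vec_norm_sum]) (simp add: vec_norm_scale)
  also have "\<dots> \<le> (\<Sum>i\<in>S. vec_norm x * vec_norm (L (basis i)))"
    by (intro sum_mono mult_right_mono coord_le_vec_norm) auto
  finally show ?thesis by (simp add: sum_distrib_left mult.commute)
qed

subsection \<open>Flags as graphs\<close>

lemma Sp_inf_RD:
  assumes "g \<in> Sp_inf_R"
  shows "lin g" "bij g" "b (g x) (g y) = b x y" "h (g x) (g y) = h x y"
    "finite {i. i \<noteq> 0 \<and> g (basis i) \<noteq> basis i}"
  using assms by (auto simp: Sp_inf_R_def Sp_inf_C_def)

lemma Sp_inf_R_compose:
  assumes f: "f \<in> Sp_inf_R" and g: "g \<in> Sp_inf_R"
  shows "f \<circ> g \<in> Sp_inf_R"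
proof -
  have "{i. i \<noteq> 0 \<and> (f \<circ> g) (basis i) \<noteq> basis i}
      \<subseteq> {i. i \<noteq> 0 \<and> f (basis i) \<noteq> basis i} \<union> {i. i \<noteq> 0 \<and> g (basis i) \<noteq> basis i}"
    by auto
  then have "finite {i. i \<noteq> 0 \<and> (f \<circ> g) (basis i) \<noteq> basis i}"
    by (rule finite_subset) (simp add: Sp_inf_RD(5)[OF f] Sp_inf_RD(5)[OF g])
  then show ?thesis
    using Sp_inf_RD(1-4)[OF f] Sp_inf_RD(1-4)[OF g]
    by (simp add: Sp_inf_R_def Sp_inf_C_def lin_compose bij_comp)
qed

lemma Sp_inf_R_bounded:
  assumes g: "g \<in> Sp_inf_R"
  obtains C where "0 < C" "\<And>x. vec_norm (g x) \<le> C * vec_norm x"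
proof -
  let ?S = "{i. i \<noteq> 0 \<and> g (basis i) \<noteq> basis i}"
  let ?L = "\<lambda>x. g x - x"
  let ?C = "\<Sum>i\<in>?S. vec_norm (?L (basis i))"
  have L: "lin ?L"
    using Sp_inf_RD(1)[OF g] by (simp add: lin_iff V.scale_right_diff_distrib)
  have "vec_norm (g x) \<le> (?C + 1) * vec_norm x" for x
  proof -
    have "vec_norm (g x) \<le> vec_norm (?L x) + vec_norm x"
      using vec_norm_triangle[of "?L x" x] by simp
    also have "vec_norm (?L x) \<le> ?C * vec_norm x"
      by (rule lin_finite_bound[OF L Sp_inf_RD(5)[OF g]]) auto
    finally show ?thesis by (simp add: algebra_simps)
  qed
  moreover have "0 < ?C + 1" by (simp add: add_nonneg_pos sum_nonneg)
  ultimately show thesis by (rule that[rotated])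
qed

text \<open>Phrased with projections, so that \<open>Z\<close> is evaluated only on
  \<open>Vminus\<close>, away from its \<open>undefined\<close> values.\<close>

definition graph :: "(vec_inf \<Rightarrow> vec_inf) \<Rightarrow> vec_inf set" where
  "graph Z = {x. pi_plus x = Z (pi_minus x)}"

text \<open>Precomposition with \<open>pi_minus\<close> extends a map given on \<open>Vminus\<close>
  to a linear map on all of \<open>V\<close>, to which the facts about \<open>lin\<close>
  apply.\<close>

lemma lin_mapsD:
  assumes "Z \<in> lin_maps Vminus Vplus"
  shows "lin (Z \<circ> pi_minus)" "x \<in> Vminus \<Longrightarrow> Z x \<in> Vplus" "Z 0 = 0"
proof -
  show "lin (Z \<circ> pi_minus)"
    using assms by (simp add: lin_iff lin_add[OF lin_pi_minus] lin_scale[OF lin_pi_minus] lin_maps_def)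
  from lin_zero[OF this] show "Z 0 = 0" by (simp add: lin_zero[OF lin_pi_minus])
  show "x \<in> Vminus \<Longrightarrow> Z x \<in> Vplus" using assms by (auto simp: lin_maps_def)
qed

lemma pi_graph_point:
  assumes "Z \<in> lin_maps Vminus Vplus" "y \<in> Vminus"
  shows "pi_plus (y + Z y) = Z y" "pi_minus (y + Z y) = y" "y + Z y \<in> graph Z"
proof -
  show "pi_plus (y + Z y) = Z y" "pi_minus (y + Z y) = y"
    using lin_mapsD(2)[OF assms] assms(2)
    by (simp_all add: lin_add[OF lin_pi_plus] lin_add[OF lin_pi_minus] pi_plus_id pi_minus_id
        pi_plus_Vminus pi_minus_Vplus)
  then show "y + Z y \<in> graph Z" by (simp add: graph_def)
qed

lemma bij_betw_graph:
  assumes Z: "Z \<in> lin_maps Vminus Vplus"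
  shows "bij_betw pi_minus (graph Z) Vminus" "bij_betw (\<lambda>y. y + Z y) Vminus (graph Z)"
proof -
  have "pi_minus x + Z (pi_minus x) = x" if "x \<in> graph Z" for x
    using that pi_sum[of x] by (simp add: graph_def add.commute)
  then show "bij_betw pi_minus (graph Z) Vminus" "bij_betw (\<lambda>y. y + Z y) Vminus (graph Z)"
    using pi_graph_point[OF Z]
    by (auto intro: bij_betw_byWitness[where f' = "\<lambda>y. y + Z y"]
        bij_betw_byWitness[where f' = pi_minus])
qed

lemma subspace_graph:
  assumes "Z \<in> lin_maps Vminus Vplus"
  shows "V.subspace (graph Z)"
  using lin_mapsD(1,3)[OF assms]
  by (auto simp: V.subspace_def graph_def lin_add[OF lin_pi_plus] lin_scale[OF lin_pi_plus]
      lin_zero[OF lin_pi_plus] lin_zero[OF lin_pi_minus] lin_iff)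

lemma flag_map_pi_minus:
  assumes "bij_betw pi_minus F Vminus" "x \<in> F"
  shows "flag_map (F0, F, F2) (pi_minus x) = pi_plus x"
  using assms by (simp add: bij_betw_def inv_into_f_f)

lemma flag_map_graph:
  assumes Z: "Z \<in> lin_maps Vminus Vplus"
  shows "flag_map (F0, graph Z, F2) = Z"
proof
  fix y
  show "flag_map (F0, graph Z, F2) y = Z y"
  proof (cases "y \<in> Vminus")
    case True
    then show ?thesis
      using flag_map_pi_minus[OF bij_betw_graph(1)[OF Z] pi_graph_point(3)[OF Z True]]
      by (simp only: pi_graph_point[OF Z True])
  next
    case False
    then show ?thesis using Z by (auto simp: lin_maps_def PiE_def extensional_def)
  qed
qed

text \<open>Since \<open>pi_minus\<close> is linear and bijective on \<open>F\<close>, linearity of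
  the quotient map can be tested on preimages in \<open>F\<close>. Together with
  \<open>flag_map_graph\<close> this matches such subspaces with linear maps.\<close>

lemma flag_map_lin_maps:
  assumes F: "V.subspace F" and bij: "bij_betw pi_minus F Vminus"
  shows "flag_map (F0, F, F2) \<in> lin_maps Vminus Vplus" (is "?Z \<in> _")
    and "graph (flag_map (F0, F, F2)) = F"
proof -
  note eq = flag_map_pi_minus[OF bij, of _ F0 F2]
  have surj: "\<exists>x\<in>F. y = pi_minus x" if "y \<in> Vminus" for y
    using bij that by (auto simp: bij_betw_def)
  have "?Z (x + y) = ?Z x + ?Z y" if xy: "x \<in> Vminus" "y \<in> Vminus" for x y
  proof -
    obtain u v where "u \<in> F" "x = pi_minus u" "v \<in> F" "y = pi_minus v" using surj xy by metis
    then show ?thesis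
      using eq[of u] eq[of v] eq[of "u + v"] F
      by (simp add: V.subspace_add lin_add[OF lin_pi_minus] lin_add[OF lin_pi_plus] del: flag_map.simps)
  qed
  moreover have "?Z (scale c x) = scale c (?Z x)" if x: "x \<in> Vminus" for x c
  proof -
    obtain u where "u \<in> F" "x = pi_minus u" using surj x by metis
    then show ?thesis
      using eq[of u] eq[of "scale c u"] F
      by (simp add: V.subspace_scale lin_scale[OF lin_pi_minus] lin_scale[OF lin_pi_plus] del: flag_map.simps)
  qed
  moreover have "?Z \<in> Vminus \<rightarrow>\<^sub>E Vplus" by auto
  ultimately show Z: "?Z \<in> lin_maps Vminus Vplus" by (simp add: lin_maps_def del: flag_map.simps)
  show "graph ?Z = F"
  proof
    show "F \<subseteq> graph ?Z" using eq by (auto simp: graph_def simp del: flag_map.simps)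
    show "graph ?Z \<subseteq> F"
    proof
      fix x assume x: "x \<in> graph ?Z"
      obtain u where u: "u \<in> F" "pi_minus x = pi_minus u" using surj[of "pi_minus x"] by auto
      then have "pi_plus x = pi_plus u"
        using x eq[OF u(1)] by (simp add: graph_def del: flag_map.simps)
      then show "x \<in> F" using u pi_sum by metis
    qed
  qed
qed

text \<open>If \<open>pi_minus (g y) = 0\<close>, then \<open>h (g y) (g y)\<close> is nonnegative
  and equals \<open>h y y\<close>, which is minus the squared norm of \<open>y\<close>. Surjectivity
  follows because \<open>pi_minus\<close> after \<open>g\<close> fixes every \<open>basis i\<close>
  with \<open>0 < i\<close> that \<open>g\<close> fixes.\<close>

lemma Sp_inf_R_image_Vminus:
  assumes g: "g \<in> Sp_inf_R"
  shows "V.subspace (g ` Vminus)" "bij_betw pi_minus (g ` Vminus) Vminus"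
proof -
  interpret vector_space_pair scale scale ..
  note gD = Sp_inf_RD[OF g]
  show sub: "V.subspace (g ` Vminus)"
    by (rule linear_subspace_image[OF gD(1) subspace_Vminus])
  have ker: "y = 0" if "y \<in> Vminus" "pi_minus (g y) = 0" for y
  proof -
    have "Re (h (g y) (g y)) = (vec_norm (pi_plus (g y)))\<^sup>2"
      by (simp add: h_self that)
    moreover have "Re (h y y) = - (vec_norm y)\<^sup>2"
      using that by (simp add: h_self pi_plus_Vminus pi_minus_id)
    ultimately have "(vec_norm y)\<^sup>2 \<le> 0"
      using zero_le_power2[of "vec_norm (pi_plus (g y))"] by (simp only: gD(4))
    then show "y = 0" by simp
  qed
  have "inj_on pi_minus (g ` Vminus)"
  proof (rule lin_inj_on[OF lin_pi_minus sub])
    fix x assume "x \<in> g ` Vminus" "pi_minus x = 0"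
    then obtain y where "x = g y" "y = 0" using ker by auto
    then show "x = 0" by (simp add: lin_zero[OF gD(1)])
  qed
  moreover have "(pi_minus \<circ> g) ` Vminus = Vminus"
  proof (rule finitary_inj_on_surj)
    show lin: "lin (pi_minus \<circ> g)" by (intro lin_compose lin_pi_minus gD)
    show "inj_on (pi_minus \<circ> g) Vminus"
      using ker by (intro lin_inj_on lin subspace_Vminus) auto
    show "Vminus = {x. supp x \<subseteq> {0<..}}" by (auto simp: Vminus_iff)
    have "pi_minus (g (basis i)) = basis i" if "0 < i" "g (basis i) = basis i" for i
      using that by (simp add: pi_minus_id basis_Vminus)
    then show "finite {i \<in> {0<..}. (pi_minus \<circ> g) (basis i) \<noteq> basis i}"
      by (intro finite_subset[OF _ gD(5)]) auto
  qed auto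
  ultimately show "bij_betw pi_minus (g ` Vminus) Vminus"
    by (simp add: bij_betw_def image_comp)
qed

text \<open>A linear bijection leaves the outer members of the flag unchanged, so only the image of
  \<open>Vminus\<close> carries information.\<close>

lemma D0E:
  assumes "F \<in> D0"
  obtains g where "g \<in> Sp_inf_R" "F = ({0}, g ` Vminus, UNIV)"
proof -
  obtain g where g: "g \<in> Sp_inf_R" "F = flag_act g base_flag" using assms by (auto simp: D0_def)
  then have "F = ({0}, g ` Vminus, UNIV)"
    using Sp_inf_RD(1,2)[OF g(1)] by (simp add: base_flag_def lin_zero bij_is_surj)
  with g(1) show thesis by (rule that)
qed

lemma D0I: "g \<in> Sp_inf_R \<Longrightarrow> ({0}, g ` Vminus, UNIV) \<in> D0"
  using Sp_inf_RD(1,2)[of g]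
  by (auto simp: D0_def base_flag_def lin_zero bij_is_surj intro!: image_eqI[where x = g])

lemma flag_act_D0:
  assumes g: "g \<in> Sp_inf_R" and F: "F \<in> D0"
  shows "flag_act g F \<in> D0"
proof -
  obtain k where k: "k \<in> Sp_inf_R" "F = ({0}, k ` Vminus, UNIV)" using F by (rule D0E)
  have "flag_act g F = ({0}, (g \<circ> k) ` Vminus, UNIV)"
    using Sp_inf_RD(1,2)[OF g] k(2) by (simp add: lin_zero bij_is_surj image_comp)
  then show ?thesis using D0I[OF Sp_inf_R_compose[OF g k(1)]] by simp
qed

lemma D0_graph:
  assumes F: "F \<in> D0"
  shows "flag_map F \<in> lin_maps Vminus Vplus" "F = ({0}, graph (flag_map F), UNIV)"
proof -
  obtain g where g: "g \<in> Sp_inf_R" "F = ({0}, g ` Vminus, UNIV)" using F by (rule D0E)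
  note F' = flag_map_lin_maps[OF Sp_inf_R_image_Vminus[OF g(1)], of "{0}" UNIV]
  show "flag_map F \<in> lin_maps Vminus Vplus" "F = ({0}, graph (flag_map F), UNIV)"
    using F' g(2) by simp_all
qed

text \<open>The components of \<open>g (y + Z y)\<close> are the values of \<open>AZ_plus_B\<close>
  and \<open>CZ_plus_D\<close> at \<open>y\<close>. As this vector lies on the graph of the new map
  \<open>Y\<close>, composing \<open>Y\<close> with \<open>CZ_plus_D\<close> gives
  \<open>AZ_plus_B\<close>; and \<open>CZ_plus_D\<close> is a composite of three bijections through
  the two graphs.\<close>

lemma D0_action:
  assumes g: "g \<in> Sp_inf_R" and F: "F \<in> D0"
  defines "Z \<equiv> flag_map F"
  shows "bij_betw (CZ_plus_D g Z) Vminus Vminus"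
    and "flag_map (flag_act g F) = frac_lin g Z"
proof -
  note glin = Sp_inf_RD(1)[OF g]
  have Z: "Z \<in> lin_maps Vminus Vplus" and F_eq: "F = ({0}, graph Z, UNIV)"
    using D0_graph[OF F] by (simp_all add: Z_def)
  define Y where "Y = flag_map (flag_act g F)"
  have Y: "Y \<in> lin_maps Vminus Vplus" and gF: "flag_act g F = ({0}, graph Y, UNIV)"
    using D0_graph[OF flag_act_D0[OF g F]] by (simp_all add: Y_def)
  have gZ: "g ` graph Z = graph Y" using F_eq gF by simp
  have C: "CZ_plus_D g Z y = pi_minus (g (y + Z y))"
    and A: "AZ_plus_B g Z y = pi_plus (g (y + Z y))" if "y \<in> Vminus" for y
    using that lin_mapsD(2)[OF Z that]
    by (simp_all add: CZ_plus_D_def AZ_plus_B_def block_A_def block_B_def block_C_def block_D_def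
        lin_add[OF glin] lin_add[OF lin_pi_minus] lin_add[OF lin_pi_plus] add.commute)
  have "bij_betw g (graph Z) (graph Y)"
    using Sp_inf_RD(2)[OF g] gZ by (metis bij_betw_subset subset_UNIV)
  then have "bij_betw (pi_minus \<circ> (g \<circ> (\<lambda>y. y + Z y))) Vminus Vminus"
    by (rule bij_betw_trans[OF bij_betw_trans[OF bij_betw_graph(2)[OF Z]] bij_betw_graph(1)[OF Y]])
  then show bij: "bij_betw (CZ_plus_D g Z) Vminus Vminus"
    by (rule bij_betw_cong[THEN iffD1, rotated]) (simp add: C)
  show "Y = frac_lin g Z"
  proof
    fix w
    show "Y w = frac_lin g Z w"
    proof (cases "w \<in> Vminus")
      case True
      define y where "y = inv_into Vminus (CZ_plus_D g Z) w"
      have y: "y \<in> Vminus" "CZ_plus_D g Z y = w"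
        using bij True by (auto simp: y_def bij_betw_def inv_into_into f_inv_into_f)
      have "g (y + Z y) \<in> graph Y" using gZ pi_graph_point(3)[OF Z y(1)] by auto
      then have "pi_plus (g (y + Z y)) = Y w" using C[OF y(1)] y(2) by (simp add: graph_def)
      then show ?thesis using True y(1) A by (simp add: frac_lin_def compose_def y_def)
    next
      \<comment> \<open>Equality of functions also concerns arguments outside \<open>Vminus\<close>,
        where both sides are \<open>undefined\<close>.\<close>
      case False
      then show ?thesis using Y
        by (auto simp: lin_maps_def PiE_def extensional_def frac_lin_def compose_def)
    qed
  qed
qed

subsection \<open>Transitivity on the domain\<close>

text \<open>Each column is a vector of finite support, so finitely many nonzero entries amount to
  finitely many nonzero columns.\<close>

lemma finitary_iff:
  assumes Z: "Z \<in> lin_maps Vminus Vplus"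
  shows "finitary (mat_of Z) \<longleftrightarrow> finite {i. 0 < i \<and> Z (basis i) \<noteq> 0}" (is "_ \<longleftrightarrow> finite ?S")
proof
  let ?P = "{(j, i). 0 < j \<and> 0 < i \<and> mat_of Z j i \<noteq> 0}"
  show "finite ?S" if "finitary (mat_of Z)"
  proof (rule finite_subset)
    show "finite (snd ` ?P)" using that by (simp add: finitary_def)
    show "?S \<subseteq> snd ` ?P"
    proof
      fix i assume i: "i \<in> ?S"
      then obtain k where k: "coord (Z (basis i)) k \<noteq> 0"
        using vec_inf_eqI[of "Z (basis i)" 0] by auto
      moreover from this have "k < 0"
        using lin_mapsD(2)[OF Z basis_Vminus] i by (auto simp: Vplus_coord not_less[symmetric])
      ultimately have "(- k, i) \<in> ?P" using i by (simp add: mat_of_def)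
      then show "i \<in> snd ` ?P" by (rule image_eqI[of i snd "(- k, i)", rotated]) simp
    qed
  qed
  show "finitary (mat_of Z)" if "finite ?S"
    unfolding finitary_def
  proof (rule finite_subset)
    show "finite (\<Union>i\<in>?S. (uminus ` supp (Z (basis i))) \<times> {i})" using that by simp
    show "?P \<subseteq> (\<Union>i\<in>?S. (uminus ` supp (Z (basis i))) \<times> {i})"
      by (auto simp: mat_of_def supp_def image_iff) (metis minus_minus)
  qed
qed

lemma b_zero [simp]: "b x 0 = 0" "b 0 x = 0"
  by (simp_all add: b_def supp_def)

lemma b_antisym: "b y x = - b x y"
  using h_conj_flip[of "conj_flip y" x] by (simp add: b_eq_h)

lemma b_basis_right: "i \<noteq> 0 \<Longrightarrow> b x (basis i) = sg (- i) * coord x (- i)"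
  by (simp add: b_eq_h conj_flip_basis h_basis_right)

lemma b_Vplus: "x \<in> Vplus \<Longrightarrow> y \<in> Vplus \<Longrightarrow> b x y = 0"
  by (auto simp: b_eq[of "supp x"] Vplus_coord intro!: sum.neutral) (metis linorder_linear neg_0_le_iff_le)

lemma b_Vminus: "x \<in> Vminus \<Longrightarrow> y \<in> Vminus \<Longrightarrow> b x y = 0"
  by (auto simp: b_eq[of "supp x"] Vminus_coord intro!: sum.neutral) (metis linorder_linear neg_le_0_iff_le)

lemma pi_basis:
  "pi_minus (basis i) = (if 0 < i then basis i else 0)"
  "pi_plus (basis i) = (if i < 0 then basis i else 0)"
  by (auto intro!: vec_inf_eqI simp: coord_simps)

text \<open>Both \<open>Vplus\<close> and \<open>Vminus\<close> are isotropic, so on the graph only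
  the mixed terms \<open>\<beta>\<close> of \<open>b\<close> survive; on basis vectors they are the
  differences of transposed entries.\<close>

lemma symmetric_iff:
  assumes Z: "Z \<in> lin_maps Vminus Vplus"
  shows "symmetric (mat_of Z) \<longleftrightarrow> (\<forall>x\<in>graph Z. \<forall>y\<in>graph Z. b x y = 0)"
proof -
  define Y where "Y = Z \<circ> pi_minus"
  have lin: "lin Y" and Y: "Y x \<in> Vplus" for x
    using lin_mapsD[OF Z] by (auto simp: Y_def)
  define \<beta> where "\<beta> x y = b (Y x) (pi_minus y) + b (pi_minus x) (Y y)" for x y
  have b_graph: "b (pi_minus x + Y x) (pi_minus y + Y y) = \<beta> x y" for x y
    using Y by (simp add: \<beta>_def b_add_left b_add_right b_Vplus b_Vminus)
  \<comment> \<open>For a nonpositive index both \<open>pi_minus\<close> and \<open>Y\<close> kill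
    the basis vector, hence the value \<open>0\<close>.\<close>
  have \<beta>_basis: "\<beta> (basis i) (basis j) =
      (if 0 < i \<and> 0 < j then mat_of Z j i - mat_of Z i j else 0)" for i j
    using b_antisym[of "basis i" "Z (basis j)"]
    by (auto simp: \<beta>_def Y_def pi_basis b_basis_right mat_of_def sg_def lin_mapsD(3)[OF Z])
  show ?thesis
  proof
    assume "symmetric (mat_of Z)"
    then have 0: "\<beta> (basis i) (basis j) = 0" for i j by (simp add: \<beta>_basis symmetric_def)
    have 1: "\<beta> x (basis j) = 0" for x j
      by (rule functional_eqI[where \<phi> = "\<lambda>x. \<beta> x (basis j)"])
        (auto simp: 0[unfolded \<beta>_def, THEN trans[OF add.commute]] \<beta>_def b_add_left b_scale_left lin_add[OF lin_pi_minus] lin_add[OF lin]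
          lin_scale[OF lin_pi_minus] lin_scale[OF lin] algebra_simps)
    have 2: "\<beta> x y = 0" for x y
      by (rule functional_eqI[where \<phi> = "\<lambda>y. \<beta> x y"])
        (auto simp: 1[unfolded \<beta>_def, THEN trans[OF add.commute]] \<beta>_def b_add_right b_scale_right lin_add[OF lin_pi_minus] lin_add[OF lin]
          lin_scale[OF lin_pi_minus] lin_scale[OF lin] algebra_simps)
    have "x = pi_minus x + Y x" if "x \<in> graph Z" for x
      using that pi_sum[of x] by (simp add: graph_def Y_def add.commute)
    then show "\<forall>x\<in>graph Z. \<forall>y\<in>graph Z. b x y = 0" using b_graph 2 by metis
  next
    assume iso: "\<forall>x\<in>graph Z. \<forall>y\<in>graph Z. b x y = 0"
    have "pi_minus x + Y x \<in> graph Z" for x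
      using pi_graph_point(3)[OF Z, of "pi_minus x"] by (simp add: Y_def)
    then have "\<beta> x y = 0" for x y using iso b_graph by metis
    then have "mat_of Z j i - mat_of Z i j = 0" if "0 < i" "0 < j" for i j
      using \<beta>_basis[of i j] that by simp
    then show "symmetric (mat_of Z)" by (simp add: symmetric_def)
  qed
qed

lemma mat_of_apply:
  assumes Z: "Z \<in> lin_maps Vminus Vplus" and x: "x \<in> Vminus"
  shows "coord (Z x) (- j) = (\<Sum>k\<in>supp x. coord x k * mat_of Z j k)"
proof -
  have "Z x = (\<Sum>k\<in>supp x. scale (coord x k) (Z (pi_minus (basis k))))"
    using lin_expand[OF lin_mapsD(1)[OF Z], of x] x by (simp add: pi_minus_id)
  also have "coord \<dots> (- j) = (\<Sum>k\<in>supp x. coord x k * mat_of Z j k)"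
    unfolding coord_sum coord_scale mat_of_def
    using x by (intro sum.cong) (auto simp: pi_basis Vminus_iff)
  finally show ?thesis .
qed

text \<open>The quadratic form of \<open>I - Z* Z\<close> at \<open>x\<close> is the squared norm of
  \<open>x\<close> minus that of \<open>Z x\<close>, and the matrix is hermitian by its
  shape.\<close>

lemma pos_def_iff:
  assumes Z: "Z \<in> lin_maps Vminus Vplus" and fin: "finitary (mat_of Z)"
  shows "pos_def (mat_minus mat_one (mat_times (mat_star (mat_of Z)) (mat_of Z)))
    \<longleftrightarrow> (\<forall>x\<in>Vminus. x \<noteq> 0 \<longrightarrow> vec_norm (Z x) < vec_norm x)"
proof -
  let ?M = "mat_of Z"
  let ?H = "mat_minus mat_one (mat_times (mat_star ?M) ?M)"
  \<comment> \<open>The finite set of nonzero rows: one summation range valid for all entries of the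
    product, so that the sums can be interchanged.\<close>
  define J where "J = fst ` {(j, i). 0 < j \<and> 0 < i \<and> ?M j i \<noteq> 0}"
  have J: "finite J" "J \<subseteq> {0<..}" using fin by (auto simp: J_def finitary_def)
  have JI: "j \<in> J" if "0 < j" "0 < k" "?M j k \<noteq> 0" for j k using that by (force simp: J_def)
  have H: "?H i k = (if i = k then 1 else 0) - (\<Sum>j\<in>J. cnj (?M j i) * ?M j k)"
    if "0 < i" "0 < k" for i k
  proof -
    have "mat_times (mat_star ?M) ?M i k = (\<Sum>j\<in>J. cnj (?M j i) * ?M j k)"
      unfolding mat_times_def mat_star_def
      using J JI that by (intro sum.mono_neutral_left) auto
    then show ?thesis by (simp add: mat_minus_def mat_one_def)
  qed
  have hermitian: "?H k i = cnj (?H i k)" if "0 < i" "0 < k" for i k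
    using that by (auto simp: H mult.commute)
  have form: "Re (\<Sum>i\<in>supp x. \<Sum>k\<in>supp x. cnj (coord x i) * ?H i k * coord x k)
      = (vec_norm x)\<^sup>2 - (vec_norm (Z x))\<^sup>2" if x: "x \<in> Vminus" for x
  proof -
    let ?w = "\<lambda>j. coord (Z x) (- j)"
    have pos: "0 < k" if "k \<in> supp x" for k using that x by (auto simp: Vminus_iff)
    have w: "?w j = (\<Sum>k\<in>supp x. ?M j k * coord x k)" for j
      by (simp add: mat_of_apply[OF Z x] mult.commute)
    have row: "(\<Sum>k\<in>supp x. cnj (coord x i) * ?H i k * coord x k)
        = cnj (coord x i) * coord x i - (\<Sum>j\<in>J. cnj (coord x i) * cnj (?M j i) * ?w j)"
      if i: "i \<in> supp x" for i
    proof -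
      have "(\<Sum>k\<in>supp x. cnj (coord x i) * ?H i k * coord x k)
        = (\<Sum>k\<in>supp x. (if k = i then cnj (coord x i) * coord x i else 0)
            - (\<Sum>j\<in>J. cnj (coord x i) * cnj (?M j i) * (?M j k * coord x k)))"
        using pos i by (intro sum.cong)
          (auto simp: H sum_distrib_left sum_distrib_right algebra_simps)
      also have "\<dots> = cnj (coord x i) * coord x i
          - (\<Sum>k\<in>supp x. \<Sum>j\<in>J. cnj (coord x i) * cnj (?M j i) * (?M j k * coord x k))"
        using i by (simp add: sum_subtractf)
      also have "(\<Sum>k\<in>supp x. \<Sum>j\<in>J. cnj (coord x i) * cnj (?M j i) * (?M j k * coord x k))
          = (\<Sum>j\<in>J. cnj (coord x i) * cnj (?M j i) * ?w j)"
        by (subst sum.swap) (simp add: w sum_distrib_left)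
      finally show ?thesis .
    qed
    have "(\<Sum>i\<in>supp x. \<Sum>k\<in>supp x. cnj (coord x i) * ?H i k * coord x k)
        = (\<Sum>i\<in>supp x. cnj (coord x i) * coord x i)
          - (\<Sum>i\<in>supp x. \<Sum>j\<in>J. cnj (coord x i) * cnj (?M j i) * ?w j)"
      by (simp add: row sum_subtractf cong: sum.cong)
    also have "(\<Sum>i\<in>supp x. \<Sum>j\<in>J. cnj (coord x i) * cnj (?M j i) * ?w j)
        = (\<Sum>j\<in>J. cnj (?w j) * ?w j)"
      by (subst sum.swap) (simp add: w sum_distrib_right sum_distrib_left mult_ac)
    finally have "(\<Sum>i\<in>supp x. \<Sum>k\<in>supp x. cnj (coord x i) * ?H i k * coord x k)
        = of_real ((\<Sum>i\<in>supp x. (cmod (coord x i))\<^sup>2) - (\<Sum>j\<in>J. (cmod (?w j))\<^sup>2))"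
      by (simp add: complex_norm_square mult.commute del: of_real_power)
    moreover have "(\<Sum>j\<in>J. (cmod (?w j))\<^sup>2) = (vec_norm (Z x))\<^sup>2"
    proof -
      have "supp (Z x) \<subseteq> uminus ` J"
      proof
        fix l assume l: "l \<in> supp (Z x)"
        then have "l < 0" using lin_mapsD(2)[OF Z x] by (auto simp: Vplus_iff)
        moreover have "?w (- l) \<noteq> 0" using l by (simp add: supp_def)
        then obtain k where "k \<in> supp x" "?M (- l) k * coord x k \<noteq> 0"
          unfolding w by (meson sum.neutral)
        ultimately have "- l \<in> J" using pos by (intro JI) auto
        then show "l \<in> uminus ` J" by force
      qed
      then show ?thesis using J(1)
        by (simp add: vec_norm_sq[of "uminus ` J"] sum.reindex)
    qed
    ultimately show ?thesis by (simp add: vec_norm_sq[of "supp x"])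
  qed
  have "0 < Re (\<Sum>i\<in>supp x. \<Sum>k\<in>supp x. cnj (coord x i) * ?H i k * coord x k)
      \<longleftrightarrow> vec_norm (Z x) < vec_norm x" if "x \<in> Vminus" for x
    unfolding form[OF that] by (auto intro: power2_less_imp_less power_strict_mono)
  then have form_iff: "(\<forall>x\<in>Vminus. x \<noteq> 0 \<longrightarrow>
      0 < Re (\<Sum>i\<in>supp x. \<Sum>k\<in>supp x. cnj (coord x i) * ?H i k * coord x k))
    \<longleftrightarrow> (\<forall>x\<in>Vminus. x \<noteq> 0 \<longrightarrow> vec_norm (Z x) < vec_norm x)"
    by (intro ball_cong imp_cong refl)
  have "\<forall>i>0. \<forall>k>0. ?H k i = cnj (?H i k)"
    by (intro allI impI hermitian)
  then show ?thesis
    unfolding pos_def_def form_iff by (intro iffI conjI) (elim conjE, assumption+)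
qed

lemma sym_domain_iff:
  "Z \<in> sym_domain \<longleftrightarrow> Z \<in> sym_maps \<and> (\<forall>x\<in>Vminus. x \<noteq> 0 \<longrightarrow> vec_norm (Z x) < vec_norm x)"
  using pos_def_iff by (auto simp: sym_domain_def sym_maps_def)

lemma sym_maps_iff:
  "Z \<in> sym_maps \<longleftrightarrow> Z \<in> lin_maps Vminus Vplus \<and> finite {i. 0 < i \<and> Z (basis i) \<noteq> 0}
    \<and> (\<forall>x\<in>graph Z. \<forall>y\<in>graph Z. b x y = 0)"
  using finitary_iff symmetric_iff by (auto simp: sym_maps_def)

section \<open>Orthonormal frames of graphs and the group elements they define\<close>

lemma h_graph_neg:
  assumes Z: "Z \<in> sym_domain" and v: "v \<in> graph Z" "v \<noteq> 0"
  shows "Re (h v v) < 0"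
proof -
  have "pi_minus v \<noteq> 0"
  proof
    assume "pi_minus v = 0"
    moreover from this have "pi_plus v = 0"
      using v lin_mapsD(3)[of Z] Z by (simp add: graph_def sym_domain_def)
    ultimately show False using v(2) pi_sum[of v] by simp
  qed
  then have "vec_norm (Z (pi_minus v)) < vec_norm (pi_minus v)"
    using Z by (simp add: sym_domain_iff)
  then have "(vec_norm (Z (pi_minus v)))\<^sup>2 < (vec_norm (pi_minus v))\<^sup>2"
    by (simp add: power_strict_mono)
  then show ?thesis using v(1) by (simp add: h_self graph_def)
qed

text \<open>Negative definiteness on the graph permits the normalization. The vanishing of
  coordinates beyond \<open>i\<close> is carried along because it keeps the next vector nonzero and
  later makes the frame orthogonal to the basis vectors of larger index.\<close>

lemma graph_Gram_Schmidt:
  assumes Z: "Z \<in> sym_domain"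
  shows "\<exists>f. (\<forall>i\<in>{1..int m}. f i \<in> graph Z \<and> (\<forall>k>i. coord (f i) k = 0))
    \<and> (\<forall>i\<in>{1..int m}. \<forall>j\<in>{1..int m}. h (f i) (f j) = (if i = j then -1 else 0))"
proof (induction m)
  case (Suc m)
  let ?I = "{1..int m}"
  let ?m = "int (Suc m)"
  obtain f where f: "\<And>i. i \<in> ?I \<Longrightarrow> f i \<in> graph Z" "\<And>i k. i \<in> ?I \<Longrightarrow> i < k \<Longrightarrow> coord (f i) k = 0"
    and orth: "\<And>i j. i \<in> ?I \<Longrightarrow> j \<in> ?I \<Longrightarrow> h (f i) (f j) = (if i = j then -1 else 0)"
    using Suc by blast
  have lm: "Z \<in> lin_maps Vminus Vplus" using Z by (simp add: sym_domain_def)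
  note sub = subspace_graph[OF lm]
  define u where "u = basis ?m + Z (basis ?m)"
  \<comment> \<open>The projections are added, not subtracted, because
    \<open>h (f i) (f i) = -1\<close>.\<close>
  define w where "w = u + (\<Sum>i\<in>?I. scale (h u (f i)) (f i))"
  have bm: "basis ?m \<in> Vminus" by (simp add: basis_Vminus)
  have w: "w \<in> graph Z"
    unfolding w_def u_def using f(1)
    by (intro V.subspace_add[OF sub] V.subspace_sum[OF sub] V.subspace_scale[OF sub]
        pi_graph_point(3)[OF lm bm]) auto
  have coord_w: "coord w k = (if k = ?m then 1 else 0)" if "?m \<le> k" for k
  proof -
    have "coord (Z (basis ?m)) k = 0"
      using lin_mapsD(2)[OF lm bm] that by (simp add: Vplus_coord)
    moreover have "coord (f i) k = 0" if "i \<in> ?I" for i using that \<open>?m \<le> k\<close> f(2) by simp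
    ultimately show ?thesis by (simp add: w_def u_def coord_simps coord_sum)
  qed
  have w0: "w \<noteq> 0" using coord_w[of ?m] by auto
  have w_orth: "h w (f j) = 0" if j: "j \<in> ?I" for j
  proof -
    have "(\<Sum>i\<in>?I. h u (f i) * h (f i) (f j)) = (\<Sum>i\<in>?I. if i = j then - h u (f j) else 0)"
      using j by (intro sum.cong) (auto simp: orth)
    then show ?thesis using j by (simp add: w_def h_add_left h_sum_left h_scale_left)
  qed
  define r where "r = - Re (h w w)"
  have r: "0 < r" using h_graph_neg[OF Z w w0] by (simp add: r_def)
  have hw: "h w w = - of_real r" by (simp add: r_def h_self)
  define c where "c = 1 / sqrt r"
  have c: "c * c * r = 1" using r by (simp add: c_def)
  define v where "v = scale (of_real c) w"
  have "h v v = - of_real (c * c * r)"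
    by (simp add: v_def h_scale_left h_scale_right hw)
  then have hv: "h v v = -1" by (simp only: c of_real_1)
  have v_orth: "h v (f j) = 0" "h (f j) v = 0" if "j \<in> ?I" for j
    using w_orth[OF that] h_commute[of w "f j"] by (simp_all add: v_def h_scale_left h_scale_right)
  have vF: "v \<in> graph Z" "coord v k = 0" if "?m < k" for k
    using w coord_w[of k] that by (simp_all add: v_def V.subspace_scale[OF sub] coord_simps)
  have split: "i \<in> {1..?m} \<longleftrightarrow> i \<in> ?I \<or> i = ?m" for i by auto
  \<comment> \<open>The premise \<open>?m < k\<close> is attached to both parts of
    \<open>vF\<close>; the choice \<open>?m + 1\<close> discharges it.\<close>
  have vF': "v \<in> graph Z" using vF(1)[of "?m + 1"] by simp
  show ?case
    by (rule exI[of _ "f(?m := v)"])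
      (use vF' vF(2) f orth hv v_orth in \<open>auto simp: split simp del: atLeastAtMost_iff of_nat_Suc\<close>)
qed simp

lemma graph_in_orbit:
  assumes Z: "Z \<in> sym_domain"
  obtains g where "g \<in> Sp_inf_R" "g ` Vminus = graph Z"
proof -
  have lm: "Z \<in> lin_maps Vminus Vplus" and fin: "finite {i. 0 < i \<and> Z (basis i) \<noteq> 0}"
    and iso: "\<And>x y. x \<in> graph Z \<Longrightarrow> y \<in> graph Z \<Longrightarrow> b x y = 0"
    using Z by (auto simp: sym_domain_iff sym_maps_iff)
  note sub = subspace_graph[OF lm]
  obtain n0 where "\<forall>i\<in>{i. 0 < i \<and> Z (basis i) \<noteq> 0}. i \<le> n0"
    using fin by (meson bdd_above_def bdd_above_finite)
  then obtain m where m: "Z (basis i) = 0" if "int m < i" for i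
    by (metis (mono_tags, lifting) dual_order.strict_trans2 mem_Collect_eq nat_le_iff not_less of_nat_0_le_iff order_refl)
  let ?I = "{1..int m}"
  obtain f0 where f0: "\<And>i. i \<in> ?I \<Longrightarrow> f0 i \<in> graph Z" "\<And>i k. i \<in> ?I \<Longrightarrow> i < k \<Longrightarrow> coord (f0 i) k = 0"
    and orth0: "\<And>i j. i \<in> ?I \<Longrightarrow> j \<in> ?I \<Longrightarrow> h (f0 i) (f0 j) = (if i = j then -1 else 0)"
    using graph_Gram_Schmidt[OF Z, of m] by blast
  \<comment> \<open>Beyond \<open>m\<close> the map \<open>Z\<close> kills the basis vectors, so
    they lie on the graph themselves; keeping them in the frame makes the resulting \<open>g\<close>
    move only finitely many basis vectors.\<close>
  define f where "f i = (if i \<in> ?I then f0 i else basis i)" for i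
  have f: "f i \<in> graph Z" if "0 < i" for i
    using that f0(1) pi_graph_point(3)[OF lm basis_Vminus, of i] m[of i] by (auto simp: f_def)
  have mixed: "h (f0 i) (basis j) = 0" "h (basis j) (f0 i) = 0" if "i \<in> ?I" "0 < j" "j \<notin> ?I" for i j
    using that f0(2)[of i j] h_basis_right[of j "f0 i"] h_commute[of "f0 i" "basis j"] by auto
  have orth: "h (f i) (f j) = (if i = j then -1 else 0)" if "0 < i" "0 < j" for i j
    using that mixed orth0 by (auto simp: f_def h_basis simp del: atLeastAtMost_iff)
  define G where "G i = (if 0 < i then f i else conj_flip (f (- i)))" for i
  have flip: "conj_flip (G i) = G (- i)" if "i \<noteq> 0" for i using that by (auto simp: G_def)
  \<comment> \<open>Equal signs of the indices use orthonormality, through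
    \<open>h_conj_flip\<close> when both are negative; opposite signs use isotropy of the graph,
    through \<open>b_eq_h\<close>.\<close>
  have hG: "h (G i) (G j) = h (basis i) (basis j)" if "i \<noteq> 0" "j \<noteq> 0" for i j
    using that orth[of i j] orth[of "- j" "- i"] iso[OF f f, of i "- j"] iso[OF f f, of j "- i"]
      h_commute[of "f j" "conj_flip (f (- i))"]
    by (auto simp: G_def h_basis h_conj_flip b_eq_h)
  \<comment> \<open>Since \<open>conj_flip\<close> reflects the index of \<open>G\<close> just as it
    does that of \<open>basis\<close>, preservation of \<open>b\<close> follows from that of
    \<open>h\<close>.\<close>
  have bG: "b (G i) (G j) = b (basis i) (basis j)" if "i \<noteq> 0" "j \<noteq> 0" for i j
    using that by (simp add: b_eq_h flip hG conj_flip_basis)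
  obtain g where lin: "lin g" and g: "\<And>i. i \<noteq> 0 \<Longrightarrow> g (basis i) = G i"
    using lin_extension[of G] by blast
  have hg: "h (g x) (g y) = h x y" for x y
    by (rule h_preserved_on_basis[OF lin]) (simp add: g hG)
  have bg: "b (g x) (g y) = b x y" for x y
    by (rule b_preserved_on_basis[OF lin]) (simp add: g bG)
  have "g (basis i) = basis i" if "i \<noteq> 0" "i \<notin> {- int m..int m}" for i
    using that by (auto simp: g G_def f_def conj_flip_basis)
  then have "{i. i \<noteq> 0 \<and> g (basis i) \<noteq> basis i} \<subseteq> {- int m..int m}" by blast
  then have fin_g: "finite {i. i \<noteq> 0 \<and> g (basis i) \<noteq> basis i}"
    by (rule finite_subset) simp
  have inj: "inj g"
  proof (rule lin_inj_on[OF lin V.subspace_UNIV])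
    fix x assume "g x = 0"
    then have "h x (basis i) = 0" for i using hg[of x "basis i"] by simp
    then have "coord x i = 0" for i
      using h_basis_right[of i x] by (cases "i = 0") (auto simp: sg_def split: if_splits)
    then show "x = 0" by (intro vec_inf_eqI) simp
  qed
  have "g ` UNIV = UNIV"
  proof (rule finitary_inj_on_surj[OF lin])
    show "UNIV = {x. supp x \<subseteq> - {0}}" by (auto simp: supp_def)
    show "finite {i \<in> - {0}. g (basis i) \<noteq> basis i}"
      by (rule finite_subset[OF _ fin_g]) auto
  qed (use inj in auto)
  with inj have "bij g" by (simp add: bij_def)
  then have gS: "g \<in> Sp_inf_R" using lin hg bg fin_g by (simp add: Sp_inf_R_def Sp_inf_C_def)
  have into: "g ` Vminus \<subseteq> graph Z"
  proof clarify
    fix x assume "x \<in> Vminus"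
    then have "g (basis i) \<in> graph Z" if "i \<in> supp x" for i
      using that f[of i] by (auto simp: Vminus_iff g G_def)
    then show "g x \<in> graph Z"
      unfolding lin_expand[OF lin, of x]
      by (intro V.subspace_sum[OF sub] V.subspace_scale[OF sub])
  qed
  \<comment> \<open>Both subspaces project bijectively onto \<open>Vminus\<close>, so the inclusion
    already shown is an equality.\<close>
  have "graph Z \<subseteq> g ` Vminus"
  proof
    fix x assume x: "x \<in> graph Z"
    obtain y where y: "y \<in> g ` Vminus" "pi_minus y = pi_minus x"
      using Sp_inf_R_image_Vminus(2)[OF gS] by (metis bij_betwE bij_betw_def imageE pi_minus_in)
    moreover have "inj_on pi_minus (graph Z)" using bij_betw_graph(1)[OF lm] by (simp add: bij_betw_def)
    ultimately show "x \<in> g ` Vminus" using x into by (metis inj_onD subsetD)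
  qed
  with into gS show thesis by (intro that) auto
qed

text \<open>All three conditions come from \<open>g\<close>: a basis vector of \<open>Vminus\<close>
  fixed by \<open>g\<close> lies on the graph and is killed by \<open>Z\<close>, isotropy is
  inherited from \<open>Vminus\<close>, and preservation of \<open>h\<close> turns its negativity
  there into the strict norm inequality.\<close>

lemma flag_map_sym_domain:
  assumes F: "F \<in> D0"
  shows "flag_map F \<in> sym_domain"
proof -
  define Z where "Z = flag_map F"
  have lm: "Z \<in> lin_maps Vminus Vplus" and F': "F = ({0}, graph Z, UNIV)"
    using D0_graph[OF F] by (simp_all add: Z_def)
  obtain g where g: "g \<in> Sp_inf_R" and "F = ({0}, g ` Vminus, UNIV)" using F by (rule D0E)
  with F' have gZ: "graph Z = g ` Vminus" by simp
  note gD = Sp_inf_RD[OF g]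
  have "Z (basis i) = 0" if "0 < i" "g (basis i) = basis i" for i
  proof -
    have "basis i \<in> graph Z" unfolding gZ using that basis_Vminus by (metis imageI)
    then show ?thesis using that by (simp add: graph_def pi_basis)
  qed
  then have "finite {i. 0 < i \<and> Z (basis i) \<noteq> 0}"
    by (intro finite_subset[OF _ gD(5)]) auto
  moreover have "\<forall>x\<in>graph Z. \<forall>y\<in>graph Z. b x y = 0"
    unfolding gZ by (auto simp: gD(3) b_Vminus)
  moreover have "vec_norm (Z x) < vec_norm x" if x: "x \<in> Vminus" "x \<noteq> 0" for x
  proof -
    obtain y where y: "y \<in> Vminus" "x + Z x = g y" using pi_graph_point(3)[OF lm x(1)] gZ by auto
    have "y \<noteq> 0" using y(2) pi_graph_point(2)[OF lm x(1)] x(2)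
      by (auto simp: lin_zero[OF gD(1)] lin_zero[OF lin_pi_minus])
    then have "0 < (vec_norm y)\<^sup>2" by simp
    moreover have "h (x + Z x) (x + Z x) = h y y" by (simp add: y(2) gD(4))
    then have "(vec_norm (Z x))\<^sup>2 - (vec_norm x)\<^sup>2 = - (vec_norm y)\<^sup>2"
      unfolding h_self of_real_eq_iff using y(1)
      by (simp add: pi_graph_point[OF lm x(1)] pi_plus_Vminus pi_minus_id)
    ultimately have "(vec_norm (Z x))\<^sup>2 < (vec_norm x)\<^sup>2" by linarith
    then show ?thesis by (rule power2_less_imp_less) simp
  qed
  ultimately show ?thesis using lm by (simp add: sym_domain_iff sym_maps_iff Z_def)
qed

lemma bij_betw_flag_map: "bij_betw flag_map D0 sym_domain"
proof (rule bij_betw_imageI)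
  show "inj_on flag_map D0" using D0_graph(2) by (metis inj_onI)
  have "Z \<in> flag_map ` D0" if Z: "Z \<in> sym_domain" for Z
  proof -
    obtain g where "g \<in> Sp_inf_R" "g ` Vminus = graph Z" using graph_in_orbit[OF Z] .
    then have "({0}, graph Z, UNIV) \<in> D0" using D0I[of g] by simp
    moreover have "flag_map ({0}, graph Z, UNIV) = Z"
      using Z by (intro flag_map_graph) (simp add: sym_domain_def)
    ultimately show ?thesis by (metis imageI)
  qed
  then show "flag_map ` D0 = sym_domain" using flag_map_sym_domain by auto
qed

subsection \<open>Topology of the domain\<close>

lemma sym_maps_le_exists:
  assumes "Z \<in> sym_maps"
  obtains n where "Z \<in> sym_maps_le n"
proof -
  let ?P = "{(j, i). 0 < j \<and> 0 < i \<and> mat_of Z j i \<noteq> 0}"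
  have "finite (fst ` ?P \<union> snd ` ?P)" using assms by (simp add: sym_maps_def finitary_def)
  then obtain n where n: "\<And>i. i \<in> fst ` ?P \<union> snd ` ?P \<Longrightarrow> i \<le> n"
    by (meson bdd_above_def bdd_above_finite)
  have "mat_of Z j i = 0" if "0 < i" "0 < j" "n < i \<or> n < j" for i j
  proof (rule ccontr)
    assume "mat_of Z j i \<noteq> 0"
    then have "(j, i) \<in> ?P" using that by simp
    then have "i \<in> snd ` ?P" "j \<in> fst ` ?P"
      by (rule image_eqI[of _ _ "(j, i)", rotated], simp)+
    then have "i \<le> n" "j \<le> n" using n by blast+
    then show False using that(3) by simp
  qed
  then show thesis using assms by (intro that[of n]) (auto simp: sym_maps_le_def)
qed

lemma ind_open_sym_maps: "ind_open sym_maps"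
  by (auto simp: ind_open_def sym_maps_le_def intro: exI[of _ 1])

lemma topspace_ind_topology: "topspace ind_topology = sym_maps"
proof
  show "topspace ind_topology \<subseteq> sym_maps"
    using openin_topspace[of ind_topology] unfolding openin_ind_topology ind_open_def by blast
  show "sym_maps \<subseteq> topspace ind_topology"
    by (rule openin_subset) (simp add: openin_ind_topology ind_open_sym_maps)
qed

text \<open>The difference of the maps has its nonzero entries in one finite square block, each
  smaller than \<open>\<epsilon>\<close>. Writing \<open>card {1..n}\<close> for the size covers
  negative \<open>n\<close> as well.\<close>

lemma sym_maps_le_diff_bound:
  assumes Z: "Z \<in> sym_maps_le n" and W: "W \<in> sym_maps_le n" and "0 \<le> \<epsilon>"
    and close: "\<forall>i\<in>{1..n}. \<forall>j\<in>{1..n}. cmod (mat_of W j i - mat_of Z j i) < \<epsilon>"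
    and x: "x \<in> Vminus"
  shows "vec_norm (W x) \<le> vec_norm (Z x) + (real (card {1..n}))\<^sup>2 * \<epsilon> * vec_norm x"
proof -
  have lm: "Z \<in> lin_maps Vminus Vplus" "W \<in> lin_maps Vminus Vplus"
    using Z W by (simp_all add: sym_maps_le_def sym_maps_def)
  define L where "L x = W (pi_minus x) - Z (pi_minus x)" for x
  have L: "lin L"
    using lin_mapsD(1)[OF lm(1)] lin_mapsD(1)[OF lm(2)]
    by (simp add: lin_iff L_def V.scale_right_diff_distrib)
  have coord_L: "coord (L (basis i)) k
      = (if 0 < i \<and> k < 0 then mat_of W (- k) i - mat_of Z (- k) i else 0)" for i k
    using lin_mapsD(2)[OF lm(1) basis_Vminus, of i] lin_mapsD(2)[OF lm(2) basis_Vminus, of i]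
    by (auto simp: L_def pi_basis coord_simps mat_of_def Vplus_coord lin_mapsD(3)[OF lm(1)]
        lin_mapsD(3)[OF lm(2)])
  have zero: "mat_of W j i - mat_of Z j i = 0" if "0 < i" "0 < j" "n < i \<or> n < j" for i j
    using Z W that by (auto simp: sym_maps_le_def)
  have "L (basis i) = 0" if "i \<notin> {1..n}" for i
    using that zero[of i] by (intro vec_inf_eqI) (auto simp: coord_L)
  then have "vec_norm (L x) \<le> (\<Sum>i\<in>{1..n}. vec_norm (L (basis i))) * vec_norm x"
    by (intro lin_finite_bound[OF L]) auto
  also have "\<dots> \<le> (\<Sum>i\<in>{1..n}. real (card {1..n}) * \<epsilon>) * vec_norm x"
  proof (intro mult_right_mono sum_mono)
    fix i assume i: "i \<in> {1..n}"
    have "supp (L (basis i)) \<subseteq> uminus ` {1..n}"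
    proof
      fix k assume "k \<in> supp (L (basis i))"
      then have "- k \<in> {1..n}" using zero[of i "- k"] by (auto simp: supp_def coord_L not_less[symmetric] split: if_splits)
      then show "k \<in> uminus ` {1..n}" by (intro image_eqI[of _ _ "- k"]) auto
    qed
    then have "vec_norm (L (basis i)) \<le> (\<Sum>k\<in>uminus ` {1..n}. cmod (coord (L (basis i)) k))"
      by (intro vec_norm_le_sum_coords) auto
    also have "\<dots> = (\<Sum>j\<in>{1..n}. cmod (mat_of W j i - mat_of Z j i))"
      using i by (subst sum.reindex) (auto simp: coord_L intro!: sum.cong)
    also have "\<dots> \<le> (\<Sum>j\<in>{1..n}. \<epsilon>)"
      using close i by (intro sum_mono) (simp add: less_imp_le)
    finally show "vec_norm (L (basis i)) \<le> real (card {1..n}) * \<epsilon>" by simp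
  qed simp
  finally have "vec_norm (L x) \<le> (real (card {1..n}))\<^sup>2 * \<epsilon> * vec_norm x"
    by (simp only: sum_constant power2_eq_square mult.assoc)
  moreover have "W x = L x + Z x" using x by (simp add: L_def pi_minus_id)
  ultimately show ?thesis using vec_norm_triangle[of "L x" "Z x"] by simp
qed

text \<open>No compactness is needed: if \<open>g\<close> maps \<open>Vminus\<close> onto the graph of \<open>Z\<close> and
  \<open>x + Z x = g y\<close>, then \<open>\<parallel>x\<parallel>\<^sup>2 - \<parallel>Z x\<parallel>\<^sup>2 = - h (g y) (g y) = \<parallel>y\<parallel>\<^sup>2\<close>, and \<open>g\<close> is bounded.\<close>

lemma sym_domain_gap:
  assumes Z: "Z \<in> sym_domain"
  obtains c where "0 < c" "\<And>x. x \<in> Vminus \<Longrightarrow> vec_norm (Z x) \<le> (1 - c) * vec_norm x"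
proof -
  have lm: "Z \<in> lin_maps Vminus Vplus" using Z by (simp add: sym_domain_def)
  obtain g where g: "g \<in> Sp_inf_R" and gZ: "g ` Vminus = graph Z" using graph_in_orbit[OF Z] .
  obtain C where C: "0 < C" "\<And>x. vec_norm (g x) \<le> C * vec_norm x"
    using Sp_inf_R_bounded[OF g] by blast
  \<comment> \<open>Chosen to rewrite the inequality \<open>p \<le> 2 * C\<^sup>2 * (p - q)\<close>
    obtained below as \<open>c * p \<le> p - q\<close>.\<close>
  define c where "c = 1 / (2 * C\<^sup>2)"
  have c: "0 < c" using C by (simp add: c_def)
  have "vec_norm (Z x) \<le> (1 - c) * vec_norm x" if x: "x \<in> Vminus" for x
  proof (cases "x = 0")
    case True
    then show ?thesis using lin_mapsD(3)[OF lm] by simp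
  next
    case False
    define p q where "p = vec_norm x" and "q = vec_norm (Z x)"
    have q: "0 \<le> q" "q < p" "0 < p" using Z x False
      by (auto simp: p_def q_def sym_domain_iff intro: le_less_trans[OF vec_norm_nonneg])
    obtain y where y: "y \<in> Vminus" "x + Z x = g y" using pi_graph_point(3)[OF lm x] gZ by auto
    have "h (x + Z x) (x + Z x) = h y y" by (simp add: y(2) Sp_inf_RD(4)[OF g])
    then have "q\<^sup>2 - p\<^sup>2 = - (vec_norm y)\<^sup>2"
      unfolding h_self of_real_eq_iff p_def q_def using y(1)
      by (simp add: pi_graph_point[OF lm x] pi_plus_Vminus pi_minus_id)
    then have "(vec_norm y)\<^sup>2 = (p - q) * (p + q)" by (simp add: power2_eq_square algebra_simps)
    moreover have "p\<^sup>2 \<le> C\<^sup>2 * (vec_norm y)\<^sup>2"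
    proof -
      have "p\<^sup>2 \<le> (vec_norm (x + Z x))\<^sup>2"
        unfolding p_def vec_norm_pythagoras[of "x + Z x"] pi_graph_point[OF lm x] by simp
      also have "\<dots> \<le> (C * vec_norm y)\<^sup>2"
        unfolding y(2) by (intro power_mono C) simp
      finally show ?thesis by (simp add: power_mult_distrib)
    qed
    ultimately have "p\<^sup>2 \<le> C\<^sup>2 * ((p - q) * (p + q))" by simp
    also have "\<dots> \<le> C\<^sup>2 * ((p - q) * (2 * p))"
      using q by (intro mult_left_mono) auto
    finally have "p * p \<le> (2 * C\<^sup>2 * (p - q)) * p" by (simp add: power2_eq_square mult_ac)
    then have "p \<le> 2 * C\<^sup>2 * (p - q)" using q by simp
    then have "c * p \<le> p - q" using C by (simp add: c_def field_simps)
    then show ?thesis by (simp add: p_def q_def algebra_simps)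
  qed
  with c show thesis by (rule that)
qed

text \<open>The strict inequality for \<open>Z\<close> improves to a uniform factor
  \<open>1 - c\<close>, and a small change of the entries raises this factor by less than
  \<open>c\<close>.\<close>

lemma ind_open_sym_domain: "ind_open sym_domain"
  unfolding ind_open_def
proof (intro conjI allI ballI)
  show "sym_domain \<subseteq> sym_maps" by (auto simp: sym_domain_iff)
  fix n Z assume Z: "Z \<in> sym_domain \<inter> sym_maps_le n"
  obtain c where c: "0 < c" "\<And>x. x \<in> Vminus \<Longrightarrow> vec_norm (Z x) \<le> (1 - c) * vec_norm x"
    using sym_domain_gap Z by blast
  define N where "N = (real (card {1..n}))\<^sup>2"
  have N: "0 \<le> N" by (simp add: N_def)
  \<comment> \<open>The denominator \<open>N + 1\<close> stays positive when the block is empty and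
    makes \<open>N * \<epsilon> < c\<close> strict.\<close>
  define \<epsilon> where "\<epsilon> = c / (N + 1)"
  have e: "0 < \<epsilon>" "N * \<epsilon> < c" using c N by (simp_all add: \<epsilon>_def field_simps)
  have "W \<in> sym_domain" if W: "W \<in> sym_maps_le n"
    and close: "\<forall>i\<in>{1..n}. \<forall>j\<in>{1..n}. cmod (mat_of W j i - mat_of Z j i) < \<epsilon>" for W
  proof -
    have "vec_norm (W x) < vec_norm x" if x: "x \<in> Vminus" "x \<noteq> 0" for x
    proof -
      have "vec_norm (W x) \<le> vec_norm (Z x) + N * \<epsilon> * vec_norm x"
        unfolding N_def using Z W close e x(1) by (intro sym_maps_le_diff_bound) auto
      also have "\<dots> \<le> (1 - c) * vec_norm x + N * \<epsilon> * vec_norm x"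
        using c(2)[OF x(1)] by simp
      also have "\<dots> = (1 - (c - N * \<epsilon>)) * vec_norm x" by (simp add: algebra_simps)
      also have "\<dots> < 1 * vec_norm x"
        using e(2) x(2) vec_norm_nonneg[of x] vec_norm_eq_0[of x]
        by (intro mult_strict_right_mono) (auto simp: order.order_iff_strict)
      finally show ?thesis by simp
    qed
    then show ?thesis using W by (simp add: sym_domain_iff sym_maps_le_def)
  qed
  with e(1) show "\<exists>\<epsilon>>0. \<forall>W\<in>sym_maps_le n.
      (\<forall>i\<in>{1..n}. \<forall>j\<in>{1..n}. cmod (mat_of W j i - mat_of Z j i) < \<epsilon>) \<longrightarrow> W \<in> sym_domain"
    by blast
qed

section \<open>Connectedness by contraction to the zero map\<close>

definition scale_map :: "real \<Rightarrow> (vec_inf \<Rightarrow> vec_inf) \<Rightarrow> vec_inf \<Rightarrow> vec_inf" where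
  "scale_map t Z = (\<lambda>x\<in>Vminus. scale (of_real t) (Z x))"

lemma mat_of_scale_map: "0 < i \<Longrightarrow> mat_of (scale_map t Z) j i = of_real t * mat_of Z j i"
  by (simp add: mat_of_def scale_map_def basis_Vminus coord_simps)

lemma scale_map_sym_maps_le:
  assumes "Z \<in> sym_maps_le n"
  shows "scale_map t Z \<in> sym_maps_le n"
proof -
  have lm: "Z \<in> lin_maps Vminus Vplus" and fin: "finitary (mat_of Z)" and sym: "symmetric (mat_of Z)"
    and le: "\<forall>i>0. \<forall>j>0. n < i \<or> n < j \<longrightarrow> mat_of Z j i = 0"
    using assms by (auto simp: sym_maps_le_def sym_maps_def)
  have "scale_map t Z \<in> lin_maps Vminus Vplus"
    using lm V.subspace_add[OF subspace_Vminus] V.subspace_scale[OF subspace_Vminus]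
      V.subspace_scale[OF subspace_Vplus]
    by (auto simp: lin_maps_def scale_map_def V.scale_right_distrib mult.commute PiE_iff)
  moreover have "finitary (mat_of (scale_map t Z))"
    unfolding finitary_def
    by (rule finite_subset[OF _ fin[unfolded finitary_def]]) (auto simp: mat_of_scale_map)
  moreover have "symmetric (mat_of (scale_map t Z))"
    using sym by (auto simp: symmetric_def mat_of_scale_map)
  ultimately show ?thesis
    using le by (auto simp: sym_maps_le_def sym_maps_def mat_of_scale_map)
qed

text \<open>All multiples of \<open>Z\<close> stay in one \<open>sym_maps_le n\<close>, where
  openness constrains finitely many entries, each linear in \<open>t\<close>.\<close>

lemma continuous_map_scale_map:
  assumes Z: "Z \<in> sym_maps"
  shows "continuous_map euclideanreal ind_topology (\<lambda>t. scale_map t Z)"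
proof -
  obtain n where n: "Z \<in> sym_maps_le n" using sym_maps_le_exists[OF Z] .
  have le: "scale_map t Z \<in> sym_maps_le n" for t using scale_map_sym_maps_le[OF n] .
  have "open {t. scale_map t Z \<in> U}" if U: "ind_open U" for U
    unfolding open_dist
  proof (intro ballI)
    fix t assume "t \<in> {t. scale_map t Z \<in> U}"
    then obtain \<epsilon> where e: "0 < \<epsilon>" and close: "\<And>W. W \<in> sym_maps_le n \<Longrightarrow>
        \<forall>i\<in>{1..n}. \<forall>j\<in>{1..n}. cmod (mat_of W j i - mat_of (scale_map t Z) j i) < \<epsilon> \<Longrightarrow> W \<in> U"
      using U le[of t] unfolding ind_open_def by blast
    \<comment> \<open>A common bound for the entries; a sum, unlike a maximum, also makes sense for
      an empty block.\<close>
    define M where "M = (\<Sum>i\<in>{1..n}. \<Sum>j\<in>{1..n}. cmod (mat_of Z j i))"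
    have M0: "0 \<le> M" by (simp add: M_def sum_nonneg)
    have M: "cmod (mat_of Z j i) \<le> M" if "i \<in> {1..n}" "j \<in> {1..n}" for i j
    proof -
      have "cmod (mat_of Z j i) \<le> (\<Sum>j\<in>{1..n}. cmod (mat_of Z j i))"
        using that by (intro member_le_sum) auto
      also have "\<dots> \<le> M"
        unfolding M_def using that
        by (intro member_le_sum[of i _ "\<lambda>i. \<Sum>j\<in>{1..n}. cmod (mat_of Z j i)"]) (auto simp: sum_nonneg)
      finally show ?thesis .
    qed
    have "scale_map s Z \<in> U" if s: "dist s t < \<epsilon> / (M + 1)" for s
    proof (rule close[OF le], intro ballI)
      fix i j assume ij: "i \<in> {1..n}" "j \<in> {1..n}"
      have "mat_of (scale_map s Z) j i - mat_of (scale_map t Z) j i = of_real (s - t) * mat_of Z j i"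
        using ij by (simp add: mat_of_scale_map algebra_simps)
      then have "cmod (mat_of (scale_map s Z) j i - mat_of (scale_map t Z) j i)
          = \<bar>s - t\<bar> * cmod (mat_of Z j i)" by (simp only: norm_mult norm_of_real)
      also have "\<dots> \<le> \<bar>s - t\<bar> * (M + 1)"
        using M[OF ij] by (intro mult_left_mono) auto
      also have "\<dots> < \<epsilon>" using s M0 by (simp add: dist_real_def pos_less_divide_eq)
      finally show "cmod (mat_of (scale_map s Z) j i - mat_of (scale_map t Z) j i) < \<epsilon>" .
    qed
    moreover have "0 < \<epsilon> / (M + 1)" using e M0 by simp
    ultimately show "\<exists>e>0. \<forall>s. dist s t < e \<longrightarrow> s \<in> {t. scale_map t Z \<in> U}" by blast
  qed
  moreover have "scale_map t Z \<in> sym_maps" for t using le[of t] by (simp add: sym_maps_le_def)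
  ultimately show ?thesis
    by (simp add: continuous_map_def topspace_ind_topology openin_ind_topology)
qed

lemma scale_map_sym_domain:
  assumes Z: "Z \<in> sym_domain" and t: "t \<in> {0..1}"
  shows "scale_map t Z \<in> sym_domain"
proof -
  have Z': "Z \<in> sym_maps" using Z by (simp add: sym_domain_iff)
  have "vec_norm (scale_map t Z x) < vec_norm x" if x: "x \<in> Vminus" "x \<noteq> 0" for x
  proof -
    have "vec_norm (scale_map t Z x) = t * vec_norm (Z x)"
      using x t by (simp add: scale_map_def vec_norm_scale)
    also have "\<dots> \<le> 1 * vec_norm (Z x)" using t by (intro mult_right_mono) auto
    also have "\<dots> < vec_norm x" using Z x by (simp add: sym_domain_iff)
    finally show ?thesis .
  qed
  moreover have "scale_map t Z \<in> sym_maps"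
    using sym_maps_le_exists[OF Z'] scale_map_sym_maps_le by (metis (no_types, lifting) mem_Collect_eq sym_maps_le_def)
  ultimately show ?thesis by (simp add: sym_domain_iff)
qed

lemma zero_sym_domain: "(\<lambda>x\<in>Vminus. 0) \<in> sym_domain"
proof -
  let ?O = "\<lambda>x\<in>Vminus. 0 :: vec_inf"
  have "?O \<in> lin_maps Vminus Vplus"
    using V.subspace_add[OF subspace_Vminus] V.subspace_scale[OF subspace_Vminus]
      V.subspace_0[OF subspace_Vplus] by (auto simp: lin_maps_def)
  moreover have "mat_of ?O j i = 0" if "0 < i" for i j
    using that by (simp add: mat_of_def basis_Vminus)
  then have "finitary (mat_of ?O)" "symmetric (mat_of ?O)"
    by (auto simp: finitary_def symmetric_def cong: conj_cong)
  ultimately show ?thesis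
    by (auto simp: sym_domain_iff sym_maps_def order.strict_iff_order)
qed

text \<open>The domain is star-shaped about the zero map: it is the union of connected segments that
  share this point, reached at \<open>t = 0\<close>.\<close>

lemma connectedin_sym_domain: "connectedin ind_topology sym_domain"
proof -
  let ?path = "\<lambda>Z. (\<lambda>t. scale_map t Z) ` {0..1}"
  have "connectedin ind_topology (\<Union>(?path ` sym_domain))"
  proof (rule connectedin_Union)
    fix S assume "S \<in> ?path ` sym_domain"
    then obtain Z where "S = ?path Z" "Z \<in> sym_maps" by (auto simp: sym_domain_iff)
    then show "connectedin ind_topology S"
      using connectedin_continuous_map_image[OF continuous_map_scale_map]
      by (metis connectedin_iff_connected connected_Icc)
  next
    have "(\<lambda>x\<in>Vminus. 0) \<in> ?path Z" for Z
      by (rule image_eqI[of _ _ 0]) (auto simp: scale_map_def)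
    then show "\<Inter>(?path ` sym_domain) \<noteq> {}" by blast
  qed
  also have "\<Union>(?path ` sym_domain) = sym_domain"
  proof
    show "\<Union>(?path ` sym_domain) \<subseteq> sym_domain" using scale_map_sym_domain by blast
    have "Z = scale_map 1 Z" if "Z \<in> sym_domain" for Z
      using that by (auto simp: scale_map_def sym_domain_def lin_maps_def PiE_def extensional_restrict
          simp flip: restrict_def)
    then show "sym_domain \<subseteq> \<Union>(?path ` sym_domain)" by force
  qed
  finally show ?thesis .
qed

lemma bounded_domain_sym_domain: "bounded_domain sym_domain"
proof -
  \<comment> \<open>The bound is \<open>1\<close> for the whole domain; \<open>x = 0\<close> is
    treated apart because the strict inequality holds only for nonzero vectors.\<close>
  have "vec_norm (Z x) \<le> 1 * vec_norm x" if "Z \<in> sym_domain" "x \<in> Vminus" for Z x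
    using that lin_mapsD(3)[of Z] by (cases "x = 0") (auto simp: sym_domain_iff sym_maps_def less_imp_le)
  then show ?thesis
    unfolding bounded_domain_def openin_ind_topology
    using zero_sym_domain ind_open_sym_domain connectedin_sym_domain by blast
qed

theorem proposition4p2p1:
  shows
    "(\<forall>(F0, F1, F2)\<in>D0. bij_betw pi_minus F1 Vminus
        \<and> (\<forall>x\<in>F1. flag_map (F0, F1, F2) (pi_minus x) = pi_plus x))
     \<and> bounded_domain sym_domain
     \<and> bij_betw flag_map D0 sym_domain
     \<and> (\<forall>g\<in>Sp_inf_R. \<forall>F\<in>D0.
          flag_act g F \<in> D0
          \<and> bij_betw (CZ_plus_D g (flag_map F)) Vminus Vminus
          \<and> flag_map (flag_act g F) = frac_lin g (flag_map F))"
proof (intro conjI ballI)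
  fix F assume "F \<in> D0"
  then obtain g where g: "g \<in> Sp_inf_R" "F = ({0}, g ` Vminus, UNIV)" by (rule D0E)
  note bij = Sp_inf_R_image_Vminus(2)[OF g(1)]
  show "case F of (F0, F1, F2) \<Rightarrow> bij_betw pi_minus F1 Vminus
        \<and> (\<forall>x\<in>F1. flag_map (F0, F1, F2) (pi_minus x) = pi_plus x)"
    using bij flag_map_pi_minus[OF bij, of _ "{0}" UNIV] by (simp add: g(2) del: flag_map.simps)
qed (simp_all add: bounded_domain_sym_domain bij_betw_flag_map flag_act_D0 D0_action)

end
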